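(* Let $\Gamma$ be a finite group of order $k\ge 2$, and let $D$ be a $d$-regular digraph with an edge-labelling $w:E(D)\to\Gamma$. If $d\ge e^3(k-1)$, where $e$ is the base of the natural logarithm, then $D$ contains a zero-sum directed cycle.
   Context: All digraphs are finite, nonempty, simple and loopless: for each ordered pair $(u,v)$ there is at most one edge from $u$ to $v$, there are no edges from a vertex to itself, and both opposite edges $uv$ and $vu$ may be present. $d^+(v)$ and $d^-(v)$ denote the outdegree and indegree of $v$. A digraph is $d$-regular if $d^+(v)=d^-(v)=d$ for every vertex $v$. A directed cycle $C=v_1v_2\cdots v_\ell v_1$ has distinct vertices $v_1,\dots,v_\ell$ and all displayed edges $v_1v_2,\dots,v_\ell v_1$ in $D$ (so $\ell\ge 2$); cycles differing by cyclic rotation are the same. $\Gamma$ is written multiplicatively with identity $1_\Gamma$ and need not be abelian. Given a labelling $w:E(D)\to\Gamma$, the ordered label product of $C$ is $w(C)=w(v_1v_2)w(v_2v_3)\cdots w(v_\ell v_1)$; $C$ is zero-sum if $w(C)=1_\Gamma$ (this does not depend on the choice of initial vertex). *)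

theory Defs
  imports
    Complex_Main
    "HOL-Algebra.Coset"
    "Graph_Theory.Digraph"
    "Graph_Theory.Arc_Walk"
begin

definition regular_digraph :: "('a, 'b) pre_digraph \<Rightarrow> nat \<Rightarrow> bool" where
  "regular_digraph D d \<longleftrightarrow> (\<forall>v \<in> verts D. out_degree D v = d \<and> in_degree D v = d)"

definition label_product :: "('g, 'm) monoid_scheme \<Rightarrow> ('b \<Rightarrow> 'g) \<Rightarrow> 'b list \<Rightarrow> 'g" where
  "label_product \<Gamma> w p = foldr (\<lambda>x y. x \<otimes>\<^bsub>\<Gamma>\<^esub> y) (map w p) \<one>\<^bsub>\<Gamma>\<^esub>"

text \<open>
  A cycle is given by its nonempty list of arcs, in order, starting at an arbitrary vertex
  of the cycle. The notion \<open>pre_digraph.cycle\<close> also admits loops, but in a loop-free digraph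
  every cycle has length at least 2, and 2-cycles are allowed.
\<close>

definition zero_sum_cycle ::
  "('g, 'm) monoid_scheme \<Rightarrow> ('a, 'b) pre_digraph \<Rightarrow> ('b \<Rightarrow> 'g) \<Rightarrow> 'b list \<Rightarrow> bool" where
  "zero_sum_cycle \<Gamma> D w p \<longleftrightarrow> pre_digraph.cycle D p \<and> label_product \<Gamma> w p = \<one>\<^bsub>\<Gamma>\<^esub>"

end

theory Submission
  imports
    "HOL-Computational_Algebra.Fundamental_Theorem_Algebra"
    "HOL-Combinatorics.Cycles"
    Defs
begin

text \<open>
  Let \<open>n\<close> be the number of vertices, \<open>A\<close> the adjacency matrix of \<open>D\<close>, and \<open>\<rho>\<close> the regular
  representation of \<open>\<Gamma>\<close> followed by the projection that kills the trivial subrepresentation.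
  Its character is \<open>- 1\<close> off the identity. Consider the block matrix \<open>B\<close> with blocks
  \<open>A u v * \<rho> (w uv)\<close> and the polynomial \<open>P x = det (1 + diag x * B)\<close> with one variable per vertex.
  The coefficient of \<open>\<Prod>v. x v\<close> in \<open>P\<close> is a signed sum over cycle covers of products of character
  values along the cycles; if there is no zero-sum cycle, all signs agree and the coefficient is,
  up to sign, the permanent of \<open>A\<close>.

  Averaging over \<open>\<bar>x v\<bar> = r\<close> and Hadamard's inequality bound the coefficient by
  \<open>(1 + r\<^sup>2 * d * (k - 1) / k) powr (n * k / 2) / r ^ n\<close>, which for \<open>r\<^sup>2 = 1 / (d * (k - 1))\<close> is
  less than \<open>(e * d * (k - 1)) powr (n / 2)\<close>. On the other hand the permanent is at least
  \<open>(d / e) ^ n\<close>, a weak form of the van der Waerden bound, which follows from Gurvits's capacity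
  argument. Hence \<open>d < e ^ 3 * (k - 1)\<close>.
\<close>

section \<open>Mixed permanents and a lower bound for permanents\<close>

text \<open>
  \<open>mixed_perm I [a\<^sub>1, ..., a\<^sub>m] c\<close> is the iterated directional derivative of \<open>\<Prod>i\<in>I. c i\<close> with
  respect to \<open>c\<close> along \<open>a\<^sub>1, ..., a\<^sub>m\<close>.
\<close>

fun mixed_perm :: "'i set \<Rightarrow> ('i \<Rightarrow> 'f::comm_semiring_1) list \<Rightarrow> ('i \<Rightarrow> 'f) \<Rightarrow> 'f" where
  "mixed_perm I [] c = (\<Prod>i\<in>I. c i)"
| "mixed_perm I (a # as) c = (\<Sum>i\<in>I. a i * mixed_perm (I - {i}) as c)"

lemma mixed_perm_cong:
  "(\<And>i. i \<in> I \<Longrightarrow> c i = c' i) \<Longrightarrow> mixed_perm I as c = mixed_perm I as c'"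
proof (induction as arbitrary: I)
  case (Cons a as)
  have "mixed_perm (I - {i}) as c = mixed_perm (I - {i}) as c'" if "i \<in> I" for i
    using Cons.prems by (intro Cons.IH) auto
  thus ?case by simp
qed (auto intro!: prod.cong)

text \<open>Directional derivatives commute: both sides expand into a sum over ordered pairs of
  distinct indices, and exchanging the two sums exchanges the directions.\<close>

lemma mixed_perm_swap:
  "finite I \<Longrightarrow> mixed_perm I (a # b # as) c = mixed_perm I (b # a # as) c"
proof -
  assume I: "finite I"
  have *: "mixed_perm I (a # b # as) c =
      (\<Sum>i\<in>I. \<Sum>j\<in>I. if i = j then 0 else a i * b j * mixed_perm (I - {i,j}) as c)" for a b
  proof -
    have "(\<Sum>j\<in>I. if i = j then 0 else a i * b j * mixed_perm (I - {i,j}) as c)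
        = a i * mixed_perm (I - {i}) (b # as) c" if "i \<in> I" for i
    proof -
      have "(\<Sum>j\<in>I. if i = j then 0 else a i * b j * mixed_perm (I - {i,j}) as c)
          = (\<Sum>j\<in>I-{i}. a i * b j * mixed_perm (I - {i,j}) as c)"
        using I by (intro sum.mono_neutral_cong_right) auto
      also have "\<dots> = a i * mixed_perm (I - {i}) (b # as) c"
        by (simp add: sum_distrib_left mult.assoc Diff_insert2 [symmetric])
      finally show ?thesis .
    qed
    thus ?thesis by simp
  qed
  show ?thesis
    unfolding * [of a b] * [of b a] by (subst sum.swap) (auto intro!: sum.cong simp: insert_commute mult_ac)
qed

text \<open>Homogeneity: each derivative lowers the degree of \<open>\<Prod>i\<in>I. c i\<close> by
  one.\<close>

lemma mixed_perm_scale: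
  "finite I \<Longrightarrow> length as \<le> card I \<Longrightarrow>
    mixed_perm I as (\<lambda>i. z * c i) = z ^ (card I - length as) * mixed_perm I as c"
proof (induction as arbitrary: I)
  case (Cons a as)
  have "a i * mixed_perm (I - {i}) as (\<lambda>i. z * c i)
      = z ^ (card I - length (a # as)) * (a i * mixed_perm (I - {i}) as c)" if "i \<in> I" for i
    using Cons.IH [of "I - {i}"] Cons.prems that by (simp add: mult_ac)
  thus ?case by (simp add: sum_distrib_left)
qed (simp add: prod.distrib)

lemma mixed_perm_pos:
  fixes c :: "'i \<Rightarrow> real"
  assumes "finite I" "length as \<le> card I" "\<And>a i. a \<in> set as \<Longrightarrow> i \<in> I \<Longrightarrow> a i > 0"
    "\<And>i. i \<in> I \<Longrightarrow> c i > 0"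
  shows "mixed_perm I as c > 0"
  using assms
proof (induction as arbitrary: I)
  case (Cons a as)
  have "I \<noteq> {}" using Cons.prems by auto
  moreover have "a i * mixed_perm (I - {i}) as c > 0" if "i \<in> I" for i
    using Cons.IH [of "I - {i}"] Cons.prems that by simp
  ultimately show ?case using Cons.prems by (simp add: sum_pos)
qed (simp add: prod_pos)

lemma of_real_mixed_perm:
  "(of_real (mixed_perm I as c) :: 'f::{real_algebra_1,comm_semiring_1}) =
    mixed_perm I (map (\<lambda>a i. of_real (a i)) as) (\<lambda>i. of_real (c i))"
  by (induction as arbitrary: I) auto

text \<open>The restriction of a mixed permanent to the line through \<open>c\<close> in direction
  \<open>b\<close>. Evaluating \<open>mixed_perm\<close> over the polynomial ring makes degree,
  roots and \<open>pderiv\<close> available for it.\<close>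

definition mixed_perm_poly ::
    "'i set \<Rightarrow> ('i \<Rightarrow> 'f::idom) list \<Rightarrow> ('i \<Rightarrow> 'f) \<Rightarrow> ('i \<Rightarrow> 'f) \<Rightarrow> 'f poly" where
  "mixed_perm_poly I as c b = mixed_perm I (map (\<lambda>a i. [:a i:]) as) (\<lambda>i. [:c i, b i:])"

lemma poly_mixed_perm_poly:
  "poly (mixed_perm_poly I as c b) t = mixed_perm I as (\<lambda>i. c i + t * b i)"
  unfolding mixed_perm_poly_def
  by (induction as arbitrary: I) (auto simp: poly_prod poly_sum)

text \<open>Differentiating along the line adds one more direction. The induction places
  \<open>b\<close> behind \<open>a\<close>; symmetry moves it to the front.\<close>

lemma poly_pderiv_mixed_perm_poly:
  fixes c :: "'i \<Rightarrow> 'f::{idom,semiring_char_0}"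
  shows "finite I \<Longrightarrow> poly (pderiv (mixed_perm_poly I as c b)) t = mixed_perm I (b # as) (\<lambda>i. c i + t * b i)"
proof (induction as arbitrary: I)
  case Nil
  have "poly (pderiv (mixed_perm_poly I [] c b)) t
      = (\<Sum>i\<in>I. (\<Prod>j\<in>I-{i}. c j + t * b j) * b i)"
    by (simp add: mixed_perm_poly_def pderiv_prod poly_sum poly_prod pderiv_pCons mult.commute)
  thus ?case by (simp add: mult.commute)
next
  case (Cons a as)
  have "mixed_perm_poly I (a # as) c b = (\<Sum>i\<in>I. smult (a i) (mixed_perm_poly (I - {i}) as c b))"
    by (simp add: mixed_perm_poly_def)
  moreover have "pderiv (\<Sum>i\<in>I. f i) = (\<Sum>i\<in>I. pderiv (f i))" for f :: "'i \<Rightarrow> 'f poly"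
    by (induction I rule: infinite_finite_induct) (auto simp: pderiv_add)
  ultimately have "poly (pderiv (mixed_perm_poly I (a # as) c b)) t
      = (\<Sum>i\<in>I. a i * mixed_perm (I - {i}) (b # as) (\<lambda>i. c i + t * b i))"
    using Cons by (simp add: pderiv_smult poly_sum)
  also have "\<dots> = mixed_perm I (a # b # as) (\<lambda>i. c i + t * b i)" by simp
  also have "\<dots> = mixed_perm I (b # a # as) (\<lambda>i. c i + t * b i)"
    by (rule mixed_perm_swap) fact
  finally show ?case .
qed

section \<open>Polynomial roots and stability of mixed permanents\<close>

text \<open>Repeated use of the fundamental theorem of algebra. The linear factors are normalised to
  the value 1 at 0, so that the logarithmic derivative at 0 is minus the sum of the inverse
  roots.\<close>

lemma complex_poly_roots_list:
  fixes p :: "complex poly"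
  assumes "poly p 0 \<noteq> 0"
  shows "\<exists>rs. (\<forall>r\<in>set rs. poly p r = 0) \<and> length rs = degree p \<and>
      p = smult (poly p 0) (\<Prod>r\<leftarrow>rs. [:1, - inverse r:])"
  using assms
proof (induction "degree p" arbitrary: p)
  case 0
  then obtain a where "p = [:a:]" by (metis degree_eq_zeroE)
  thus ?case by (intro exI [of _ "[]"]) auto
next
  case (Suc n)
  have "\<not> constant (poly p)" using Suc.hyps(2) by (simp add: constant_degree)
  then obtain r where r: "poly p r = 0" using fundamental_theorem_of_algebra by blast
  have r0: "r \<noteq> 0" using r Suc.prems by auto
  from r obtain q where q: "p = [:-r, 1:] * q" by (metis dvdE poly_eq_0_iff_dvd)
  have q0: "q \<noteq> 0" using q Suc.prems by auto
  have dq: "degree q = n" using Suc.hyps(2) q0 unfolding q by (subst (asm) degree_mult_eq) auto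
  have pq: "poly p 0 = - r * poly q 0" by (simp add: q)
  obtain rs where rs: "\<forall>r\<in>set rs. poly q r = 0" "length rs = degree q"
      "q = smult (poly q 0) (\<Prod>r\<leftarrow>rs. [:1, - inverse r:])"
    using Suc.hyps(1) [of q] dq pq Suc.prems by auto
  have "p = smult (poly p 0) ([:1, - inverse r:] * (\<Prod>r\<leftarrow>rs. [:1, - inverse r:]))"
  proof -
    have "smult (poly p 0) ([:1, - inverse r:] * (\<Prod>r\<leftarrow>rs. [:1, - inverse r:]))
        = smult (- r) [:1, - inverse r:] * smult (poly q 0) (\<Prod>r\<leftarrow>rs. [:1, - inverse r:])"
      by (simp only: pq mult_smult_left mult_smult_right smult_smult mult.commute [of "poly q 0"])
    also have "smult (- r) [:1, - inverse r:] = [:-r, 1:]" using r0 by simp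
    finally show ?thesis using rs(3) q by simp
  qed
  hence "p = smult (poly p 0) (\<Prod>r\<leftarrow>r # rs. [:1, - inverse r:])" by simp
  moreover have "\<forall>s\<in>set (r # rs). poly p s = 0" using rs(1) r by (simp add: q)
  moreover have "length (r # rs) = degree p" using rs(2) dq Suc.hyps(2) by simp
  ultimately show ?case by blast
qed

lemma poly_prod_list_linear:
  fixes rs :: "complex list"
  shows "poly (pderiv (\<Prod>r\<leftarrow>rs. [:1, - inverse r:])) 0 = - (\<Sum>r\<leftarrow>rs. inverse r)"
    and "poly (\<Prod>r\<leftarrow>rs. [:1, - inverse r:]) t = (\<Prod>r\<leftarrow>rs. 1 - t * inverse r)"
proof -
  show 2: "poly (\<Prod>r\<leftarrow>rs. [:1, - inverse r:]) t = (\<Prod>r\<leftarrow>rs. 1 - t * inverse r)" for t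
    by (induction rs) (auto simp: algebra_simps)
  show "poly (pderiv (\<Prod>r\<leftarrow>rs. [:1, - inverse r:])) 0 = - (\<Sum>r\<leftarrow>rs. inverse r)"
  proof (induction rs)
    case (Cons r rs)
    have "poly (\<Prod>r\<leftarrow>rs. [:1, - inverse r:]) 0 = 1"
      by (induction rs) auto
    with Cons show ?case
      by (simp del: mult_pCons_left add: pderiv_mult) (simp add: pderiv_pCons)
  qed auto
qed

text \<open>
  Stability is preserved by a directional derivative: the logarithmic derivative at \<open>0\<close> of a
  polynomial with all roots in the lower half plane is a sum of numbers with negative imaginary part.
\<close>

lemma mixed_perm_nonzero_upper_half_plane:
  fixes c :: "'i \<Rightarrow> complex" and as :: "('i \<Rightarrow> real) list"
  assumes "finite I" "length as \<le> card I" "\<And>a i. a \<in> set as \<Longrightarrow> i \<in> I \<Longrightarrow> a i > 0"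
    "\<And>i. i \<in> I \<Longrightarrow> Im (c i) > 0"
  shows "mixed_perm I (map (\<lambda>a i. complex_of_real (a i)) as) c \<noteq> 0"
  using assms
proof (induction as arbitrary: c)
  case Nil
  thus ?case by (force simp: prod_zero_iff)
next
  case (Cons a as)
  let ?as = "map (\<lambda>a i. complex_of_real (a i)) as" and ?a = "\<lambda>i. complex_of_real (a i)"
  define p where "p = mixed_perm_poly I ?as c ?a"
  define m where "m = card I - length as"
  have m: "m > 0" using Cons.prems(2) by (simp add: m_def)
  have a: "a i > 0" if "i \<in> I" for i using Cons.prems(3) that by simp
  \<comment> \<open>A positive real direction keeps all imaginary parts positive throughout the
    closed upper half plane, so the induction hypothesis applies at every such
    \<open>t\<close>.\<close>
  have nz: "poly p t \<noteq> 0" if "Im t \<ge> 0" for t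
    unfolding p_def poly_mixed_perm_poly
  proof (rule Cons.IH)
    fix i assume "i \<in> I"
    thus "Im (c i + t * ?a i) > 0" using Cons.prems(4) [of i] a [of i] that
      by (simp add: add_pos_nonneg)
  qed (use Cons.prems in auto)
  \<comment> \<open>At least one root is needed for a nonzero logarithmic derivative. If
    \<open>p\<close> were constant, its reversal \<open>q\<close>, obtained by exchanging base point
    and direction, would be a monomial of positive degree \<open>m\<close> and vanish at 0; but
    \<open>poly q 0\<close> is a mixed permanent of positive reals.\<close>
  have deg: "degree p \<noteq> 0"
  proof
    assume "degree p = 0"
    then obtain \<kappa> where \<kappa>: "p = [:\<kappa>:]" by (metis degree_eq_zeroE)
    define q where "q = mixed_perm_poly I ?as ?a c"
    \<comment> \<open>Homogeneity determines \<open>q\<close> only away from 0. The extra factor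
      \<open>[:0,1:]\<close> makes both sides agree at 0 as well and is cancelled afterwards as a
      polynomial.\<close>
    have "poly ([:0,1:] * q) s = poly (monom \<kappa> (Suc m)) s" for s
    proof (cases "s = 0")
      case False
      have "poly q s = mixed_perm I ?as (\<lambda>i. s * (c i + inverse s * ?a i))"
        unfolding q_def poly_mixed_perm_poly using False by (intro mixed_perm_cong) (auto simp: field_simps)
      also have "\<dots> = s ^ m * poly p (inverse s)"
        unfolding p_def poly_mixed_perm_poly m_def using Cons.prems by (subst mixed_perm_scale) auto
      finally show ?thesis by (simp add: \<kappa> poly_monom)
    qed (simp add: poly_monom)
    hence "[:0,1:] * q = monom \<kappa> (Suc m)" using poly_eq_poly_eq_iff by blast
    hence "q = monom \<kappa> m" by (simp add: monom_Suc)
    hence "poly q 0 = 0" using m by (simp add: poly_monom)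
    moreover have "poly q 0 = of_real (mixed_perm I as a)"
      by (simp add: q_def poly_mixed_perm_poly of_real_mixed_perm)
    moreover have "mixed_perm I as a > 0"
      using Cons.prems by (intro mixed_perm_pos) auto
    ultimately show False by simp
  qed
  obtain rs where rs: "\<forall>r\<in>set rs. poly p r = 0" "length rs = degree p"
      "p = smult (poly p 0) (\<Prod>r\<leftarrow>rs. [:1, - inverse r:])"
    using complex_poly_roots_list [of p] nz [of 0] by auto
  have "poly (pderiv p) 0 = - poly p 0 * (\<Sum>r\<leftarrow>rs. inverse r)"
    by (subst rs(3)) (simp add: pderiv_smult poly_prod_list_linear)
  moreover have "rs \<noteq> []" using deg rs(2) by auto
  hence "Im (\<Sum>r\<leftarrow>rs. inverse r) > 0" using rs(1)
  proof (induction rs rule: list_nonempty_induct)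
    case (single r)
    hence "Im r < 0" using nz [of r] by (auto simp: not_le [symmetric])
    thus ?case by (simp add: divide_pos_pos sum_power2_gt_zero_iff divide_neg_pos)
  next
    case (cons r rs)
    hence "Im r < 0" using nz [of r] by (auto simp: not_le [symmetric])
    hence "Im (inverse r) > 0" by (simp add: sum_power2_gt_zero_iff divide_neg_pos)
    with cons show ?case by simp
  qed
  ultimately have "poly (pderiv p) 0 \<noteq> 0" using nz [of 0] by auto
  thus ?case unfolding p_def using Cons.prems(1) by (simp add: poly_pderiv_mixed_perm_poly)
qed

text \<open>
  By stability and homogeneity the left-hand side is a real-rooted polynomial in \<open>t\<close>; apply
  \<open>1 + s \<le> exp s\<close> to each linear factor.
\<close>

lemma mixed_perm_exp_bound:
  fixes c b :: "'i \<Rightarrow> real"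
  assumes "finite I" "length as \<le> card I" "\<And>a i. a \<in> set as \<Longrightarrow> i \<in> I \<Longrightarrow> a i > 0"
    and c: "\<And>i. i \<in> I \<Longrightarrow> c i > 0" and b: "\<And>i. i \<in> I \<Longrightarrow> b i > 0" and t: "t \<ge> 0"
  shows "mixed_perm I as (\<lambda>i. c i + t * b i)
    \<le> mixed_perm I as c * exp (t * (mixed_perm I (b # as) c / mixed_perm I as c))"
proof -
  let ?as = "map (\<lambda>a i. complex_of_real (a i)) as"
  define p where "p = mixed_perm_poly I ?as (\<lambda>i. of_real (c i)) (\<lambda>i. of_real (b i))"
  have pt: "poly p (of_real s) = of_real (mixed_perm I as (\<lambda>i. c i + s * b i))" for s
    by (simp add: p_def poly_mixed_perm_poly of_real_mixed_perm)
  have p0: "poly p 0 = of_real (mixed_perm I as c)" using pt [of 0] by simp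
  have pos: "mixed_perm I as c > 0" using assms by (intro mixed_perm_pos) auto
  \<comment> \<open>All roots are negative reals: stability excludes the upper half plane, stability
    after scaling all arguments by -1 excludes the lower one, and positivity excludes the
    nonnegative reals.\<close>
  have root: "Im r = 0 \<and> Re r < 0" if r: "poly p r = 0" for r
  proof -
    have "\<not> Im r > 0"
    proof
      assume "Im r > 0"
      hence "mixed_perm I ?as (\<lambda>i. of_real (c i) + r * of_real (b i)) \<noteq> 0"
        using assms by (intro mixed_perm_nonzero_upper_half_plane) auto
      thus False using r by (simp add: p_def poly_mixed_perm_poly)
    qed
    moreover have "\<not> Im r < 0"
    proof
      assume "Im r < 0"
      hence "mixed_perm I ?as (\<lambda>i. (-1) * (of_real (c i) + r * of_real (b i))) \<noteq> 0"
        using assms by (intro mixed_perm_nonzero_upper_half_plane) (auto simp: mult_neg_pos)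
      thus False using r assms by (subst (asm) mixed_perm_scale) (auto simp: p_def poly_mixed_perm_poly)
    qed
    ultimately have im: "Im r = 0" by simp
    have "\<not> Re r \<ge> 0"
    proof
      assume re: "Re r \<ge> 0"
      have "mixed_perm I as (\<lambda>i. c i + Re r * b i) > 0"
        using assms re by (intro mixed_perm_pos) (auto intro!: add_pos_nonneg simp: less_imp_le)
      moreover have "r = of_real (Re r)" using im by (simp add: complex_eq_iff)
      hence "of_real (mixed_perm I as (\<lambda>i. c i + Re r * b i)) = (0::complex)" using r pt [of "Re r"] by simp
      ultimately show False by (simp only: of_real_eq_0_iff)
    qed
    thus ?thesis using im by simp
  qed
  obtain rs where rs: "\<forall>r\<in>set rs. poly p r = 0"
      "p = smult (poly p 0) (\<Prod>r\<leftarrow>rs. [:1, - inverse r:])"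
    using complex_poly_roots_list [of p] p0 pos by auto
  have real_rs: "inverse r = of_real (- (1 / (- Re r)))" if "r \<in> set rs" for r
  proof -
    have "r = of_real (Re r)" using root [of r] rs(1) that by (simp add: complex_eq_iff)
    hence "inverse r = of_real (inverse (Re r))" by (metis of_real_inverse)
    thus ?thesis by (simp add: inverse_eq_divide)
  qed
  have "poly (pderiv p) 0 = - poly p 0 * (\<Sum>r\<leftarrow>rs. inverse r)"
    by (subst rs(2)) (simp add: pderiv_smult poly_prod_list_linear)
  also have "(\<Sum>r\<leftarrow>rs. inverse r) = (\<Sum>r\<leftarrow>rs. of_real (- (1 / (- Re r))))"
    using real_rs by (intro arg_cong [of _ _ sum_list] map_cong) auto
  also have "\<dots> = - of_real (\<Sum>r\<leftarrow>rs. 1 / (- Re r))"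
    by (induction rs) auto
  finally have "of_real (mixed_perm I (b # as) c) =
      (of_real (mixed_perm I as c * (\<Sum>r\<leftarrow>rs. 1 / (- Re r))) :: complex)"
    using assms(1) unfolding p0 by (simp add: p_def poly_pderiv_mixed_perm_poly of_real_mixed_perm del: of_real_divide)
  \<comment> \<open>The slopes of the normalised linear factors are positive and add up to the
    logarithmic derivative in direction \<open>b\<close>.\<close>
  hence d: "mixed_perm I (b # as) c / mixed_perm I as c = (\<Sum>r\<leftarrow>rs. 1 / (- Re r))"
    using pos by (simp only: of_real_eq_iff) (simp add: field_simps)
  have "poly p (of_real t) = poly p 0 * (\<Prod>r\<leftarrow>rs. 1 - of_real t * inverse r)"
    by (subst rs(2)) (simp add: poly_prod_list_linear)
  also have "(\<Prod>r\<leftarrow>rs. 1 - of_real t * inverse r) = (\<Prod>r\<leftarrow>rs. of_real (1 + t * (1 / (- Re r))))"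
    using real_rs by (intro arg_cong [of _ _ prod_list] map_cong) auto
  also have "\<dots> = of_real (\<Prod>r\<leftarrow>rs. 1 + t * (1 / (- Re r)))"
    by (induction rs) auto
  finally have "mixed_perm I as (\<lambda>i. c i + t * b i) = mixed_perm I as c * (\<Prod>r\<leftarrow>rs. 1 + t * (1 / (- Re r)))"
    unfolding pt p0 by (simp only: of_real_mult [symmetric] of_real_eq_iff)
  \<comment> \<open>Nonnegativity is carried through the induction so that the inequalities of the
    factors can be multiplied.\<close>
  moreover have "(\<Prod>r\<leftarrow>rs. 1 + t * (1 / (- Re r))) \<le> exp (t * (\<Sum>r\<leftarrow>rs. 1 / (- Re r)))
      \<and> (\<Prod>r\<leftarrow>rs. 1 + t * (1 / (- Re r))) \<ge> 0"
    using rs(1)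
  proof (induction rs)
    case (Cons r rs)
    define s where "s = 1 / (- Re r)"
    have "s > 0" using root [of r] Cons.prems by (auto simp: s_def)
    hence "0 \<le> t * s" using t by (intro mult_nonneg_nonneg) auto
    moreover have "1 + t * s \<le> exp (t * s)" by (rule exp_ge_add_one_self)
    moreover have "exp (t * (\<Sum>r\<leftarrow>r # rs. 1 / (- Re r))) =
        exp (t * s) * exp (t * (\<Sum>r\<leftarrow>rs. 1 / (- Re r)))"
      by (simp only: list.map sum_list.Cons distrib_left exp_add s_def)
    moreover have "(\<Prod>r\<leftarrow>r # rs. 1 + t * (1 / (- Re r))) =
        (1 + t * s) * (\<Prod>r\<leftarrow>rs. 1 + t * (1 / (- Re r)))"
      by (simp only: list.map prod_list.Cons s_def)
    moreover have "(\<Prod>r\<leftarrow>rs. 1 + t * (1 / (- Re r))) \<le> exp (t * (\<Sum>r\<leftarrow>rs. 1 / (- Re r)))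
      \<and> (\<Prod>r\<leftarrow>rs. 1 + t * (1 / (- Re r))) \<ge> 0"
      using Cons by simp
    ultimately show ?case by (simp only:) (intro conjI mult_mono mult_nonneg_nonneg; linarith)
  qed simp
  ultimately show ?thesis unfolding d using pos by (simp only:) (intro mult_left_mono, auto)
qed

section \<open>Gurvits's capacity argument\<close>

text \<open>Weighted AM-GM for each \<open>i\<close> with weights \<open>a v i / d\<close>. After
  multiplying over \<open>i\<close>, the other family of sums turns the exponent of every
  \<open>x v\<close> into 1.\<close>

lemma doubly_stochastic_prod_bound:
  fixes a :: "'v \<Rightarrow> 'i \<Rightarrow> real"
  assumes fin: "finite V" "finite I" and d: "d > 0"
    and a: "\<And>v i. v \<in> V \<Longrightarrow> i \<in> I \<Longrightarrow> a v i \<ge> 0"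
    and rows: "\<And>i. i \<in> I \<Longrightarrow> (\<Sum>v\<in>V. a v i) = d"
    and cols: "\<And>v. v \<in> V \<Longrightarrow> (\<Sum>i\<in>I. a v i) = d"
    and x: "\<And>v. v \<in> V \<Longrightarrow> x v > 0"
  shows "d ^ card I * (\<Prod>v\<in>V. x v) \<le> (\<Prod>i\<in>I. \<Sum>v\<in>V. a v i * x v)"
proof -
  define M where "M i = (\<Sum>v\<in>V. a v i * x v) / d" for i
  have M: "M i > 0" if i: "i \<in> I" for i
  proof -
    have "\<exists>v\<in>V. a v i \<noteq> 0" using rows [OF i] d by (metis sum.neutral less_irrefl)
    then obtain v where "v \<in> V" "a v i > 0" using a i by (force simp: less_le)
    hence "(\<Sum>v\<in>V. a v i * x v) > 0"
      using fin a x i by (intro sum_pos2 [of _ v]) (auto intro!: mult_nonneg_nonneg simp: less_imp_le)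
    thus ?thesis using d by (simp add: M_def)
  qed
  have "(\<Sum>v\<in>V. a v i * ln (x v)) \<le> d * ln (M i)" if i: "i \<in> I" for i
  proof -
    \<comment> \<open>AM-GM from \<open>ln y \<le> y - 1\<close> at \<open>y = x v / M i\<close>;
      the resulting bound is 0 because \<open>M i\<close> is the weighted mean of the
      \<open>x v\<close>.\<close>
    have "(\<Sum>v\<in>V. a v i * ln (x v)) - (\<Sum>v\<in>V. a v i) * ln (M i) = (\<Sum>v\<in>V. a v i * ln (x v / M i))"
      using x [THEN less_imp_neq] x M [OF i]
      by (simp add: ln_divide_pos sum_subtractf right_diff_distrib sum_distrib_right)
    also have "\<dots> \<le> (\<Sum>v\<in>V. a v i * (x v / M i - 1))"
      using x M [OF i] a i by (intro sum_mono mult_left_mono ln_le_minus_one) auto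
    also have "\<dots> = (\<Sum>v\<in>V. a v i * x v) / M i - (\<Sum>v\<in>V. a v i)"
      by (simp add: sum_subtractf right_diff_distrib sum_divide_distrib)
    also have "\<dots> = 0"
    proof -
      have "(\<Sum>v\<in>V. a v i * x v) = d * M i" using d by (simp add: M_def)
      thus ?thesis using M [OF i] rows [OF i] by simp
    qed
    finally show ?thesis using rows [OF i] by simp
  qed
  hence "(\<Sum>i\<in>I. \<Sum>v\<in>V. a v i * ln (x v)) \<le> (\<Sum>i\<in>I. d * ln (M i))" by (rule sum_mono)
  also have "(\<Sum>i\<in>I. \<Sum>v\<in>V. a v i * ln (x v)) = (\<Sum>v\<in>V. d * ln (x v))"
    by (subst sum.swap) (simp add: sum_distrib_right [symmetric] cols)
  finally have "d * (\<Sum>v\<in>V. ln (x v)) \<le> d * (\<Sum>i\<in>I. ln (M i))" by (simp add: sum_distrib_left)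
  hence "(\<Sum>v\<in>V. ln (x v)) \<le> (\<Sum>i\<in>I. ln (M i))" using d by simp
  hence "exp (\<Sum>v\<in>V. ln (x v)) \<le> exp (\<Sum>i\<in>I. ln (M i))" by simp
  hence "(\<Prod>v\<in>V. x v) \<le> (\<Prod>i\<in>I. M i)" using fin x M by (simp add: exp_sum)
  hence "d ^ card I * (\<Prod>v\<in>V. x v) \<le> d ^ card I * (\<Prod>i\<in>I. M i)" using d by simp
  also have "\<dots> = (\<Prod>i\<in>I. d * M i)" by (simp add: prod.distrib)
  finally show ?thesis using d by (simp add: M_def)
qed

text \<open>Gurvits's induction: the variables in \<open>vs\<close> have been differentiated away at
  0, each at the cost of a factor \<open>exp 1\<close>. The offset \<open>c\<close> keeps the linear
  forms positive when no variables remain; once all of \<open>V\<close> is differentiated, the mixed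
  permanent no longer depends on it.\<close>

lemma mixed_perm_capacity_bound:
  fixes a :: "'v \<Rightarrow> 'i \<Rightarrow> real"
  assumes fin: "finite V" "finite I" and card: "card V = card I" and d: "d > 0"
    and a: "\<And>v i. v \<in> V \<Longrightarrow> i \<in> I \<Longrightarrow> a v i > 0"
    and rows: "\<And>i. i \<in> I \<Longrightarrow> (\<Sum>v\<in>V. a v i) = d"
    and cols: "\<And>v. v \<in> V \<Longrightarrow> (\<Sum>i\<in>I. a v i) = d"
    and c: "\<And>i. i \<in> I \<Longrightarrow> c i > 0"
    and vs: "distinct vs" "set vs \<subseteq> V"
    and x: "\<And>v. v \<in> V - set vs \<Longrightarrow> x v > 0"
  shows "exp (- real (length vs)) * d ^ card I * (\<Prod>v\<in>V - set vs. x v)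
    \<le> mixed_perm I (map a vs) (\<lambda>i. c i + (\<Sum>v\<in>V - set vs. a v i * x v))"
  using vs x
proof (induction vs arbitrary: x)
  case Nil
  have "d ^ card I * (\<Prod>v\<in>V. x v) \<le> (\<Prod>i\<in>I. \<Sum>v\<in>V. a v i * x v)"
    using Nil by (intro doubly_stochastic_prod_bound fin d rows cols) (auto intro: less_imp_le a)
  also have "\<dots> \<le> (\<Prod>i\<in>I. c i + (\<Sum>v\<in>V. a v i * x v))"
    using Nil c by (intro prod_mono conjI sum_nonneg) (auto intro!: mult_nonneg_nonneg simp: less_imp_le a)
  finally show ?case by simp
next
  case (Cons v vs)
  define W where "W = V - set (v # vs)"
  define C where "C = (\<lambda>i. c i + (\<Sum>u\<in>W. a u i * x u))"
  have W: "V - set vs = insert v W" "finite W" "v \<notin> W" "W \<subseteq> V"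
    using Cons.prems fin by (auto simp: W_def)
  have xW: "x u > 0" if "u \<in> W" for u using Cons.prems that by (auto simp: W_def)
  have v: "v \<in> V" using Cons.prems by auto
  have C: "C i > 0" if "i \<in> I" for i
    unfolding C_def using W xW that c by (intro add_pos_nonneg sum_nonneg mult_nonneg_nonneg)
      (auto intro!: less_imp_le a)
  have len: "length (v # vs) \<le> card I"
    using Cons.prems(1,2) fin card by (metis card_mono distinct_card)
  have as_pos: "f i > 0" if "f \<in> set (map a (v # vs))" "i \<in> I" for f i
    using that Cons.prems(2) by (auto intro: a)
  define G where "G = mixed_perm I (map a vs) C"
  define G' where "G' = mixed_perm I (map a (v # vs)) C"
  have G: "G > 0" unfolding G_def using fin len as_pos C by (intro mixed_perm_pos) auto
  have G': "G' > 0" unfolding G'_def using fin len as_pos C by (intro mixed_perm_pos) auto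
  \<comment> \<open>This \<open>t\<close> minimises \<open>G * exp (t * G' / G) / t\<close>, an
    upper bound for what remains after dividing by the new variable; the exponent becomes 1 and the
    quotient \<open>G' * exp 1\<close>. The induction hypothesis is then used with \<open>v\<close>
    as a free variable of value \<open>t\<close>.\<close>
  define t where "t = G / G'"
  have t: "t > 0" using G G' by (simp add: t_def)
  define y where "y = x(v := t)"
  have "exp (- real (length vs)) * d ^ card I * (\<Prod>u\<in>V - set vs. y u)
      \<le> mixed_perm I (map a vs) (\<lambda>i. c i + (\<Sum>u\<in>V - set vs. a u i * y u))"
    using Cons.prems t by (intro Cons.IH) (auto simp: y_def)
  also have "(\<Prod>u\<in>V - set vs. y u) = t * (\<Prod>u\<in>W. x u)"
    unfolding W(1) using W by (auto simp: y_def intro!: prod.cong)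
  also have "(\<lambda>i. c i + (\<Sum>u\<in>V - set vs. a u i * y u)) = (\<lambda>i. C i + t * a v i)"
  proof
    fix i
    have "(\<Sum>u\<in>W. a u i * y u) = (\<Sum>u\<in>W. a u i * x u)"
      using W by (intro sum.cong) (auto simp: y_def)
    thus "c i + (\<Sum>u\<in>V - set vs. a u i * y u) = C i + t * a v i"
      unfolding W(1) using W by (simp add: C_def y_def)
  qed
  also have "mixed_perm I (map a vs) (\<lambda>i. C i + t * a v i)
      \<le> G * exp (t * (mixed_perm I (a v # map a vs) C / G))"
    unfolding G_def using fin len as_pos C a v t by (intro mixed_perm_exp_bound) auto
  also have "t * (mixed_perm I (a v # map a vs) C / G) = 1"
    using G G' by (simp add: t_def G'_def)
  finally have "exp (- real (length vs)) * d ^ card I * (\<Prod>u\<in>W. x u) * t \<le> G * exp 1"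
    by (simp only: mult_ac)
  hence "exp (- real (length vs)) * d ^ card I * (\<Prod>u\<in>W. x u) \<le> G' * exp 1"
    using G G' by (simp add: t_def field_simps)
  hence "exp (- real (length vs)) * d ^ card I * (\<Prod>u\<in>W. x u) * exp (-1) \<le> G' * exp 1 * exp (-1)"
    by (intro mult_right_mono) auto
  also have "G' * exp 1 * exp (-1) = G'" by (simp add: mult.assoc exp_add [symmetric])
  also have "exp (- real (length vs)) * d ^ card I * (\<Prod>u\<in>W. x u) * exp (-1)
      = exp (- real (length (v # vs))) * d ^ card I * (\<Prod>u\<in>W. x u)"
    by (simp add: exp_diff exp_minus field_simps exp_add)
  finally show ?case by (simp add: G'_def C_def W_def)
qed

text \<open>With as many directions as indices no factor of \<open>c\<close> survives, and unfolding
  assigns to each direction an index not taken before.\<close>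

lemma mixed_perm_full:
  assumes "finite I" "distinct vs" "card I = length vs"
  shows "mixed_perm I (map a vs) c =
    (\<Sum>f \<in> {f \<in> set vs \<rightarrow>\<^sub>E I. inj_on f (set vs)}. \<Prod>v\<in>set vs. a v (f v))"
  using assms
proof (induction vs arbitrary: I)
  case Nil
  thus ?case by (simp add: PiE_empty_domain cong: conj_cong)
next
  case (Cons v vs)
  let ?F = "\<lambda>I vs. {f \<in> set vs \<rightarrow>\<^sub>E I. inj_on f (set vs)}"
  have v: "v \<notin> set vs" using Cons.prems by simp
  have fin: "finite (?F I vs)" if "finite I" for I
    using that by (intro finite_subset [OF _ finite_PiE [of "set vs" "\<lambda>_. I"]]) auto
  have "mixed_perm I (map a (v # vs)) c =
      (\<Sum>i\<in>I. \<Sum>f\<in>?F (I - {i}) vs. a v i * (\<Prod>u\<in>set vs. a u (f u)))"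
    using Cons by (simp add: sum_distrib_left)
  also have "\<dots> = (\<Sum>(i,f)\<in>Sigma I (\<lambda>i. ?F (I - {i}) vs). a v i * (\<Prod>u\<in>set vs. a u (f u)))"
    using Cons.prems fin by (intro sum.Sigma) auto
  also have "\<dots> = (\<Sum>f\<in>?F I (v # vs). \<Prod>u\<in>set (v # vs). a u (f u))"
  proof (intro sum.reindex_bij_witness [of _ "\<lambda>f. (f v, f(v := undefined))" "\<lambda>(i, f). f(v := i)"])
    fix p assume p: "p \<in> Sigma I (\<lambda>i. ?F (I - {i}) vs)"
    obtain i f where [simp]: "p = (i, f)" by (cases p)
    have f: "i \<in> I" "f \<in> set vs \<rightarrow>\<^sub>E I - {i}" "inj_on f (set vs)" using p by auto
    have fv: "f v = undefined" using f(2) v by (auto simp: PiE_def extensional_def)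
    show "(\<lambda>f. (f v, f(v := undefined))) ((\<lambda>(i, f). f(v := i)) p) = p"
      using fv by auto
    have "inj_on (f(v := i)) (set (v # vs))"
      using f v by (auto simp: inj_on_def PiE_def Pi_def)
    moreover have "f(v := i) \<in> set (v # vs) \<rightarrow>\<^sub>E I"
      using f by (auto simp: PiE_def Pi_def extensional_def)
    ultimately show "(\<lambda>(i, f). f(v := i)) p \<in> ?F I (v # vs)" by simp
    have "(\<Prod>u\<in>set vs. a u ((f(v := i)) u)) = (\<Prod>u\<in>set vs. a u (f u))"
      using v by (intro prod.cong) auto
    thus "(\<Prod>u\<in>set (v # vs). a u ((\<lambda>(i, f). f(v := i)) p u)) =
        (\<lambda>(i, f). a v i * (\<Prod>u\<in>set vs. a u (f u))) p"
      using v by simp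
  next
    fix f assume f: "f \<in> ?F I (v # vs)"
    show "(\<lambda>(i, f). f(v := i)) ((\<lambda>f. (f v, f(v := undefined))) f) = f" by auto
    show "(\<lambda>f. (f v, f(v := undefined))) f \<in> Sigma I (\<lambda>i. ?F (I - {i}) vs)"
      using f v by (auto simp: PiE_def Pi_def extensional_def inj_on_def)
  qed
  finally show ?case .
qed

section \<open>Permanents and their exponential lower bound\<close>

definition permanent :: "'v set \<Rightarrow> ('v \<Rightarrow> 'v \<Rightarrow> 'f::comm_semiring_1) \<Rightarrow> 'f" where
  "permanent V A = (\<Sum>p | p permutes V. \<Prod>v\<in>V. A v (p v))"

text \<open>Passes between two encodings of a permutation: \<open>permutes\<close> means the
  identity outside \<open>V\<close>, an extensional function is \<open>undefined\<close> there.
  Finiteness turns injectivity into bijectivity.\<close>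

lemma sum_permutes_eq_sum_inj_PiE:
  assumes "finite V"
  shows "(\<Sum>p | p permutes V. g (restrict p V)) = (\<Sum>f \<in> {f \<in> V \<rightarrow>\<^sub>E V. inj_on f V}. g f)"
proof (intro sum.reindex_bij_witness
    [of _ "\<lambda>f v. if v \<in> V then f v else v" "\<lambda>p. restrict p V"])
  fix p assume p: "p \<in> {p. p permutes V}"
  show "(\<lambda>v. if v \<in> V then restrict p V v else v) = p"
    using p by (auto simp: permutes_def)
  show "restrict p V \<in> {f \<in> V \<rightarrow>\<^sub>E V. inj_on f V}"
    using p by (auto simp: permutes_in_image permutes_inj_on)
next
  fix f assume f: "f \<in> {f \<in> V \<rightarrow>\<^sub>E V. inj_on f V}"
  have "f ` V = V" using f assms by (intro endo_inj_surj) auto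
  hence "bij_betw f V V" using f by (simp add: bij_betw_def)
  hence "bij_betw (\<lambda>v. if v \<in> V then f v else v) V V" by (subst bij_betw_cong [of _ _ f]) auto
  thus "(\<lambda>v. if v \<in> V then f v else v) \<in> {p. p permutes V}"
    by (auto intro!: bij_imp_permutes)
  show "restrict (\<lambda>v. if v \<in> V then f v else v) V = f"
    using f by (auto simp: PiE_def extensional_def fun_eq_iff)
qed auto

lemma permanent_eq_mixed_perm:
  assumes "finite V" "set vs = V" "distinct vs"
  shows "permanent V A = mixed_perm V (map A vs) c"
proof -
  have "permanent V A = (\<Sum>p | p permutes V. \<Prod>v\<in>V. A v (restrict p V v))"
    unfolding permanent_def by (intro sum.cong prod.cong) auto
  also have "\<dots> = (\<Sum>f \<in> {f \<in> V \<rightarrow>\<^sub>E V. inj_on f V}. \<Prod>v\<in>V. A v (f v))"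
    by (rule sum_permutes_eq_sum_inj_PiE) fact
  also have "\<dots> = mixed_perm V (map A vs) c"
    using mixed_perm_full [of V vs A c] assms distinct_card [of vs] by simp
  finally show ?thesis .
qed

text \<open>The capacity bound asks for positive entries, so every entry is raised by \<epsilon>,
  which keeps all row and column sums equal; then \<epsilon> tends to 0 and continuity of the
  permanent gives the claim.\<close>

lemma permanent_ge_exp:
  fixes A :: "'v \<Rightarrow> 'v \<Rightarrow> real"
  assumes fin: "finite V" and d: "d > 0"
    and A: "\<And>u v. u \<in> V \<Longrightarrow> v \<in> V \<Longrightarrow> A u v \<ge> 0"
    and rows: "\<And>v. v \<in> V \<Longrightarrow> (\<Sum>u\<in>V. A v u) = d"
    and cols: "\<And>v. v \<in> V \<Longrightarrow> (\<Sum>u\<in>V. A u v) = d"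
  shows "permanent V A \<ge> (d / exp 1) ^ card V"
proof -
  obtain vs where vs: "set vs = V" "distinct vs" using finite_distinct_list [OF fin] by blast
  have "(d / exp 1) ^ card V \<le> permanent V (\<lambda>u v. A u v + \<epsilon>)" if \<epsilon>: "\<epsilon> > 0" for \<epsilon>
  proof -
    let ?d = "d + real (card V) * \<epsilon>"
    \<comment> \<open>As \<open>vs\<close> exhausts \<open>V\<close>, the capacity bound is used
      with no free variables left; its offset is set to 1.\<close>
    have len: "length vs = card V" using vs by (metis distinct_card)
    have "exp (- real (length vs)) * ?d ^ card V * (\<Prod>v\<in>V - set vs. 1)
      \<le> mixed_perm V (map (\<lambda>u v. A u v + \<epsilon>) vs) (\<lambda>i. 1 + (\<Sum>v\<in>V - set vs. (A v i + \<epsilon>) * 1))"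
      using vs fin d A \<epsilon> by (intro mixed_perm_capacity_bound)
        (auto simp: sum.distrib rows cols add_pos_nonneg add_nonneg_pos)
    hence "exp (- real (card V)) * ?d ^ card V \<le> permanent V (\<lambda>u v. A u v + \<epsilon>)"
      using fin vs len by (simp add: permanent_eq_mixed_perm [of V vs _ "\<lambda>i. 1"])
    moreover have "exp (- real (card V)) * d ^ card V \<le> exp (- real (card V)) * ?d ^ card V"
      using d \<epsilon> by (intro mult_left_mono power_mono) auto
    moreover have "(d / exp 1) ^ card V = exp (- real (card V)) * d ^ card V"
      using exp_of_nat_mult [of "card V" "1::real"]
      by (simp add: power_divide exp_minus field_simps)
    ultimately show ?thesis by linarith
  qed
  hence "eventually (\<lambda>\<epsilon>. (d / exp 1) ^ card V \<le> permanent V (\<lambda>u v. A u v + \<epsilon>)) (at_right 0)"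
    by (auto simp: eventually_at_right_less intro: eventually_mono [OF eventually_at_right_less])
  moreover have "((\<lambda>\<epsilon>. permanent V (\<lambda>u v. A u v + \<epsilon>)) \<longlongrightarrow> permanent V (\<lambda>u v. A u v + 0)) (at_right 0)"
    unfolding permanent_def by (intro tendsto_intros)
  ultimately show ?thesis
    using tendsto_lowerbound [of _ "permanent V A" "at_right (0::real)"] by simp
qed

section \<open>Determinants over finite index sets and Hadamard's inequality\<close>

text \<open>The index set is an argument, so principal minors and block matrices need no numbering
  of rows.\<close>

definition set_det :: "'i set \<Rightarrow> ('i \<Rightarrow> 'i \<Rightarrow> 'f::comm_ring_1) \<Rightarrow> 'f" where
  "set_det S A = (\<Sum>p | p permutes S. of_int (sign p) * (\<Prod>i\<in>S. A i (p i)))"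

text \<open>Lets a principal minor on the graph of a function be read as a determinant over its
  domain. Transport by \<open>map_permutation\<close> preserves signs.\<close>

lemma set_det_image:
  assumes f: "inj_on f S" and "finite S"
  shows "set_det (f ` S) A = set_det S (\<lambda>i j. A (f i) (f j))"
  unfolding set_det_def
proof (rule sym, intro sum.reindex_bij_witness
    [of _ "map_permutation (f ` S) (inv_into S f)" "map_permutation S f"])
  have bij: "bij_betw f S (f ` S)" using f by (simp add: bij_betw_def)
  have inj: "inj_on (inv_into S f) (f ` S)" by (intro inj_on_inv_into order.refl)
  fix p assume p: "p \<in> {p. p permutes S}"
  show "map_permutation S f p \<in> {p. p permutes f ` S}"
    using p bij by (auto intro: map_permutation_permutes)
  have "map_permutation (f ` S) (inv_into S f) (map_permutation S f p) = map_permutation S (inv_into S f \<circ> f) p"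
    using bij inj by (rule map_permutation_compose)
  also have "\<dots> = map_permutation S id p" using p f
    by (intro map_permutation_cong) (auto simp: inj_on_def)
  also have "\<dots> = p" using p by simp
  finally show "map_permutation (f ` S) (inv_into S f) (map_permutation S f p) = p" .
  have "map_permutation S f p (f i) = f (p i)" if "i \<in> S" for i
    using f that by (simp add: map_permutation_def restrict_id_def)
  thus "of_int (sign (map_permutation S f p)) * (\<Prod>i\<in>f ` S. A i (map_permutation S f p i)) =
      of_int (sign p) * (\<Prod>i\<in>S. A (f i) (f (p i)))"
    using p assms by (simp add: sign_map_permutation prod.reindex)
next
  have bij: "bij_betw (inv_into S f) (f ` S) S" using f
    by (simp only: bij_betw_inv_into inj_on_imp_bij_betw)
  fix p assume p: "p \<in> {p. p permutes f ` S}"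
  show "map_permutation (f ` S) (inv_into S f) p \<in> {p. p permutes S}"
    using p bij by (auto intro: map_permutation_permutes)
  have "map_permutation S f (map_permutation (f ` S) (inv_into S f) p) =
      map_permutation (f ` S) (f \<circ> inv_into S f) p"
    using bij f by (rule map_permutation_compose)
  also have "\<dots> = map_permutation (f ` S) id p" using p f
    by (intro map_permutation_cong) (auto simp: inj_on_def f_inv_into_f)
  also have "\<dots> = p" using p by simp
  finally show "map_permutation S f (map_permutation (f ` S) (inv_into S f) p) = p" .
qed

text \<open>Expand each product by the set \<open>T\<close> of rows contributing the entry of
  \<open>B\<close>. In the other rows the identity matrix forces fixed points, so only permutations
  of \<open>T\<close> survive.\<close>

lemma set_det_add_diagonal:
  assumes S: "finite S"
  shows "set_det S (\<lambda>i j. of_bool (i = j) + c i * B i j) = (\<Sum>T\<in>Pow S. (\<Prod>i\<in>T. c i) * set_det T B)"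
proof -
  define t where "t T p = of_int (sign p) * ((\<Prod>i\<in>T. c i * B i (p i)) * (\<Prod>i\<in>S-T. of_bool (i = p i)))" for T p
  have "set_det S (\<lambda>i j. of_bool (i = j) + c i * B i j)
      = (\<Sum>p | p permutes S. of_int (sign p) * (\<Prod>i\<in>S. c i * B i (p i) + of_bool (i = p i)))"
    by (simp add: set_det_def add.commute)
  also have "\<dots> = (\<Sum>p | p permutes S. \<Sum>T\<in>Pow S. t T p)"
    using S by (simp add: prod_add sum_distrib_left t_def)
  also have "\<dots> = (\<Sum>T\<in>Pow S. \<Sum>p | p permutes S. t T p)" by (rule sum.swap)
  also have "\<dots> = (\<Sum>T\<in>Pow S. (\<Prod>i\<in>T. c i) * set_det T B)"
  proof (intro sum.cong refl)
    fix T assume T: "T \<in> Pow S"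
    have fin: "finite {p. p permutes S}" using S by (rule finite_permutations)
    have sub: "{p. p permutes T} \<subseteq> {p. p permutes S}"
    proof
      fix p assume "p \<in> {p. p permutes T}"
      hence "p permutes T" by (rule CollectD)
      hence "p permutes S" by (rule permutes_subset) (rule PowD [OF T])
      thus "p \<in> {p. p permutes S}" by simp
    qed
    have zero: "t T p = 0" if p: "p permutes S" "\<not> p permutes T" for p
    proof -
      obtain i where i: "i \<in> S - T" "i \<noteq> p i"
        using p(2) permutes_superset [OF p(1), of T] by metis
      have "(\<Prod>i\<in>S-T. of_bool (i = p i) :: 'b) = 0"
        by (rule prod_zero) (use S i in auto)
      thus ?thesis by (simp add: t_def)
    qed
    have eq: "t T p = of_int (sign p) * (\<Prod>i\<in>T. c i * B i (p i))" if "p permutes T" for p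
    proof -
      have "(\<Prod>i\<in>S-T. of_bool (i = p i) :: 'b) = 1"
        by (rule prod.neutral) (use that in \<open>simp add: permutes_not_in\<close>)
      thus ?thesis by (simp add: t_def)
    qed
    have "(\<Sum>p | p permutes S. t T p) = (\<Sum>p | p permutes T. of_int (sign p) * (\<Prod>i\<in>T. c i * B i (p i)))"
      by (rule sum.mono_neutral_cong_right [OF fin sub])
        (use zero eq in blast)+
    thus "(\<Sum>p | p permutes S. t T p) = (\<Prod>i\<in>T. c i) * set_det T B"
      by (simp add: set_det_def sum_distrib_left prod.distrib mult_ac)
  qed
  finally show ?thesis .
qed

section \<open>Hadamard's inequality by orthogonalisation\<close>

lemma set_det_transpose:
  assumes S: "finite S"
  shows "set_det S (\<lambda>i j. A j i) = set_det S A"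
proof -
  have "set_det S (\<lambda>i j. A j i) = (\<Sum>p | p permutes S. of_int (sign (inv_into UNIV p)) * (\<Prod>i\<in>S. A (inv_into UNIV p i) i))"
    unfolding set_det_def by (rule sum_permutations_inverse)
  also have "\<dots> = set_det S A"
    unfolding set_det_def
  proof (intro sum.cong refl)
    fix p assume "p \<in> {p. p permutes S}"
    hence p: "p permutes S" by simp
    have "sign (inv_into UNIV p) = sign p" using p S by (intro sign_inverse permutes_imp_permutation)
    moreover have "(\<Prod>i\<in>S. A (inv_into UNIV p i) i) = (\<Prod>i\<in>S. A i (p i))"
      using prod.permute [OF p, of "\<lambda>i. A (inv_into UNIV p i) i"] p by (simp add: o_def permutes_inverses)
    ultimately show "of_int (sign (inv_into UNIV p)) * (\<Prod>i\<in>S. A (inv_into UNIV p i) i) = of_int (sign p) * (\<Prod>i\<in>S. A i (p i))"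
      by simp
  qed
  finally show ?thesis .
qed

text \<open>Composing with the transposition of the two rows flips every sign and changes no
  product, so the determinant is its own negative.\<close>

lemma set_det_equal_rows:
  fixes A :: "'i \<Rightarrow> 'i \<Rightarrow> complex"
  assumes S: "finite S" and ij: "i \<in> S" "j \<in> S" "i \<noteq> j" and eq: "\<And>k. k \<in> S \<Longrightarrow> A i k = A j k"
  shows "set_det S A = 0"
proof -
  let ?\<tau> = "transpose i j"
  have \<tau>: "?\<tau> permutes S" using ij by (simp add: permutes_swap_id)
  have row: "A (?\<tau> x) k = A x k" if "k \<in> S" for x k
    using eq [OF that] by (simp add: transpose_def)
  have "set_det S A = (\<Sum>p | p permutes S. of_int (sign (p \<circ> ?\<tau>)) * (\<Prod>x\<in>S. A x ((p \<circ> ?\<tau>) x)))"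
    unfolding set_det_def by (rule sum_permutations_compose_right [OF \<tau>])
  also have "\<dots> = (\<Sum>p | p permutes S. - (of_int (sign p) * (\<Prod>x\<in>S. A x (p x))))"
  proof (intro sum.cong refl)
    fix p assume "p \<in> {p. p permutes S}"
    hence p: "p permutes S" by simp
    have "sign (p \<circ> ?\<tau>) = - sign p" using p ij S
      by (subst sign_compose) (auto simp: sign_swap_id permutation_swap_id permutes_imp_permutation)
    moreover have "(\<Prod>x\<in>S. A x ((p \<circ> ?\<tau>) x)) = (\<Prod>x\<in>S. A x (p x))"
    proof -
      have "(\<Prod>x\<in>S. A x ((p \<circ> ?\<tau>) x)) = (\<Prod>x\<in>S. A (?\<tau> x) (p (?\<tau> x)))"
        using p \<tau> by (intro prod.cong refl) (simp add: row permutes_in_image)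
      also have "\<dots> = (\<Prod>x\<in>S. A x (p x))"
        using prod.permute [OF \<tau>, of "\<lambda>x. A x (p x)"] by (simp add: o_def)
      finally show ?thesis .
    qed
    ultimately show "of_int (sign (p \<circ> ?\<tau>)) * (\<Prod>x\<in>S. A x ((p \<circ> ?\<tau>) x)) = - (of_int (sign p) * (\<Prod>x\<in>S. A x (p x)))"
      by simp
  qed
  also have "\<dots> = - set_det S A" by (simp add: set_det_def sum_negf)
  finally show ?thesis by simp
qed

lemma set_det_add_row:
  fixes A :: "'i \<Rightarrow> 'i \<Rightarrow> complex"
  assumes S: "finite S" and ij: "i \<in> S" "j \<in> S" "i \<noteq> j"
  shows "set_det S (A(i := \<lambda>k. A i k + c * A j k)) = set_det S A"
proof -
  have prod_upd: "(\<Prod>x\<in>S. (A(i := r)) x (p x)) = r (p i) * (\<Prod>x\<in>S-{i}. A x (p x))" for r p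
    using S ij by (subst prod.remove [of _ i]) (auto intro!: prod.cong)
  have "set_det S (A(i := \<lambda>k. A i k + c * A j k)) = set_det S (A(i := A i)) + c * set_det S (A(i := A j))"
    unfolding set_det_def prod_upd by (simp add: sum.distrib [symmetric] sum_distrib_left algebra_simps)
  also have "set_det S (A(i := A j)) = 0"
    using ij by (intro set_det_equal_rows [OF S ij]) auto
  finally show ?thesis by (simp only: fun_upd_triv mult_zero_right add_0_right)
qed

lemma set_det_add_rows:
  fixes A :: "'i \<Rightarrow> 'i \<Rightarrow> complex"
  assumes S: "finite S" and "finite U" "U \<subseteq> S - {j}" and j: "j \<in> S"
  shows "set_det S (\<lambda>i k. if i \<in> U then A i k + c i * A j k else A i k) = set_det S A"
  using assms(2,3)
proof (induction U rule: finite_induct)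
  case (insert u U)
  let ?B = "\<lambda>i k. if i \<in> U then A i k + c i * A j k else A i k"
  have upd: "(\<lambda>i k. if i \<in> insert u U then A i k + c i * A j k else A i k)
      = ?B(u := \<lambda>k. ?B u k + c u * ?B j k)"
    using insert.hyps insert.prems by (intro ext) auto
  have "set_det S (?B(u := \<lambda>k. ?B u k + c u * ?B j k)) = set_det S ?B"
    by (rule set_det_add_row [OF S _ j]) (use insert.prems in blast)+
  also have "\<dots> = set_det S A"
    by (rule insert.IH) (use insert.prems in blast)
  finally show ?case unfolding upd .
qed simp

text \<open>The squared norm is the determinant of the Gram matrix of the rows, which is diagonal
  here. The multiplicativity used is proved by hand, as in the Cauchy-Binet formula.\<close>

lemma norm_set_det_orthogonal_rows:
  fixes A :: "'i \<Rightarrow> 'i \<Rightarrow> complex"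
  assumes S: "finite S" and orth: "\<And>i j. i \<in> S \<Longrightarrow> j \<in> S \<Longrightarrow> i \<noteq> j \<Longrightarrow> (\<Sum>k\<in>S. A i k * cnj (A j k)) = 0"
  shows "(norm (set_det S A))\<^sup>2 = (\<Prod>i\<in>S. \<Sum>k\<in>S. (norm (A i k))\<^sup>2)"
proof -
  \<comment> \<open>The conjugate determinant with columns selected by \<open>f\<close>: zero if a
    column repeats, and a signed copy of the original if \<open>f\<close> is a permutation.\<close>
  let ?D = "\<lambda>f. \<Sum>q | q permutes S. of_int (sign q) * (\<Prod>i\<in>S. cnj (A (q i) (f i)))"
  have D: "?D f = set_det S (\<lambda>i j. cnj (A j (f i)))" for f
    by (simp add: set_det_def)
  have D_noninj: "?D f = 0" if f: "f \<in> S \<rightarrow>\<^sub>E S" "\<not> inj_on f S" for f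
  proof -
    from f obtain i j where "i \<in> S" "j \<in> S" "i \<noteq> j" "f i = f j" by (auto simp: inj_on_def)
    thus ?thesis unfolding D by (intro set_det_equal_rows [OF S, of i j]) auto
  qed
  have D_perm: "?D p = of_int (sign p) * cnj (set_det S A)" if p: "p permutes S" for p
  proof -
    have "?D p = (\<Sum>q | q permutes S. of_int (sign (q \<circ> p)) * (\<Prod>i\<in>S. cnj (A ((q \<circ> p) i) (p i))))"
      by (rule sum_permutations_compose_right [OF p])
    also have "\<dots> = of_int (sign p) * (\<Sum>q | q permutes S. of_int (sign q) * (\<Prod>i\<in>S. cnj (A (q i) i)))"
      unfolding sum_distrib_left
    proof (intro sum.cong refl)
      fix q assume "q \<in> {q. q permutes S}"
      hence "sign (q \<circ> p) = sign q * sign p"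
        using p S by (intro sign_compose) (auto intro: permutes_imp_permutation)
      moreover have "(\<Prod>i\<in>S. cnj (A ((q \<circ> p) i) (p i))) = (\<Prod>i\<in>S. cnj (A (q i) i))"
        using prod.permute [OF p, of "\<lambda>i. cnj (A (q i) i)"] by (simp add: o_def)
      ultimately show "of_int (sign (q \<circ> p)) * (\<Prod>i\<in>S. cnj (A ((q \<circ> p) i) (p i))) =
          of_int (sign p) * (of_int (sign q) * (\<Prod>i\<in>S. cnj (A (q i) i)))"
        by simp
    qed
    also have "(\<Sum>q | q permutes S. of_int (sign q) * (\<Prod>i\<in>S. cnj (A (q i) i))) = cnj (set_det S A)"
      using set_det_transpose [OF S, of "\<lambda>i j. cnj (A i j)"] by (simp add: set_det_def)
    finally show ?thesis .
  qed
  have fin: "finite (S \<rightarrow>\<^sub>E S)" using S by (simp add: finite_PiE)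
  have "complex_of_real ((norm (set_det S A))\<^sup>2) = set_det S A * cnj (set_det S A)"
    by (rule complex_norm_square)
  also have "\<dots> = (\<Sum>p | p permutes S. (\<Prod>i\<in>S. A i (p i)) * ?D p)"
  proof -
    have "set_det S A * cnj (set_det S A) =
        (\<Sum>p | p permutes S. (\<Prod>i\<in>S. A i (p i)) * (of_int (sign p) * cnj (set_det S A)))"
      by (subst (1) set_det_def, unfold sum_distrib_right, intro sum.cong refl) (simp add: mult_ac)
    also have "\<dots> = (\<Sum>p | p permutes S. (\<Prod>i\<in>S. A i (p i)) * ?D p)"
    proof (intro sum.cong refl)
      fix p assume "p \<in> {p. p permutes S}"
      hence "?D p = of_int (sign p) * cnj (set_det S A)" by (intro D_perm) simp
      thus "(\<Prod>i\<in>S. A i (p i)) * (of_int (sign p) * cnj (set_det S A)) = (\<Prod>i\<in>S. A i (p i)) * ?D p"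
        by (simp only:)
    qed
    finally show ?thesis .
  qed
  also have "\<dots> = (\<Sum>p | p permutes S. (\<Prod>i\<in>S. A i (restrict p S i)) * ?D (restrict p S))"
    by (intro sum.cong refl arg_cong2 [where f = "(*)"] prod.cong) simp_all
  also have "\<dots> = (\<Sum>f\<in>{f \<in> S \<rightarrow>\<^sub>E S. inj_on f S}. (\<Prod>i\<in>S. A i (f i)) * ?D f)"
    by (rule sum_permutes_eq_sum_inj_PiE [OF S])
  \<comment> \<open>Noninjective \<open>f\<close> contribute 0. Summing over all functions makes the
    sum factor row by row into inner products.\<close>
  also have "\<dots> = (\<Sum>f\<in>S \<rightarrow>\<^sub>E S. (\<Prod>i\<in>S. A i (f i)) * ?D f)"
  proof (intro sum.mono_neutral_left fin ballI)
    fix f assume "f \<in> (S \<rightarrow>\<^sub>E S) - {f \<in> S \<rightarrow>\<^sub>E S. inj_on f S}"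
    hence "?D f = 0" by (intro D_noninj) auto
    thus "(\<Prod>i\<in>S. A i (f i)) * ?D f = 0" by (simp only: mult_zero_right)
  qed auto
  also have "\<dots> = (\<Sum>f\<in>S \<rightarrow>\<^sub>E S. \<Sum>q | q permutes S. of_int (sign q) * (\<Prod>i\<in>S. A i (f i) * cnj (A (q i) (f i))))"
    unfolding sum_distrib_left prod.distrib by (intro sum.cong refl) (simp only: mult_ac)
  also have "\<dots> = (\<Sum>q | q permutes S. of_int (sign q) * (\<Sum>f\<in>S \<rightarrow>\<^sub>E S. \<Prod>i\<in>S. A i (f i) * cnj (A (q i) (f i))))"
    unfolding sum_distrib_left by (rule sum.swap)
  also have "\<dots> = (\<Sum>q | q permutes S. of_int (sign q) * (\<Prod>i\<in>S. \<Sum>k\<in>S. A i k * cnj (A (q i) k)))"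
    by (simp only: prod_sum_PiE [OF S S])
  also have "\<dots> = (\<Sum>q\<in>{id}. of_int (sign q) * (\<Prod>i\<in>S. \<Sum>k\<in>S. A i k * cnj (A (q i) k)))"
  proof (intro sum.mono_neutral_right ballI)
    show "finite {q. q permutes S}" using S by (rule finite_permutations)
    show "{id} \<subseteq> {q. q permutes S}" by (simp add: permutes_id)
    fix q assume q: "q \<in> {q. q permutes S} - {id}"
    then obtain i where i: "q i \<noteq> i" by (metis DiffE ext id_apply insertI1)
    have "i \<in> S" using i q by (metis DiffD1 mem_Collect_eq permutes_not_in)
    moreover have "q i \<in> S" using q \<open>i \<in> S\<close> by (simp add: permutes_in_image)
    ultimately have "(\<Sum>k\<in>S. A i k * cnj (A (q i) k)) = 0" using i by (intro orth) auto
    hence "(\<Prod>i\<in>S. \<Sum>k\<in>S. A i k * cnj (A (q i) k)) = 0"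
      using S \<open>i \<in> S\<close> by (intro prod_zero) auto
    thus "of_int (sign q) * (\<Prod>i\<in>S. \<Sum>k\<in>S. A i k * cnj (A (q i) k)) = 0" by simp
  qed
  also have "\<dots> = complex_of_real (\<Prod>i\<in>S. \<Sum>k\<in>S. (norm (A i k))\<^sup>2)"
    by (simp only: complex_norm_square of_real_sum of_real_prod) simp
  finally show ?thesis by (simp only: of_real_eq_iff)
qed

text \<open>Gram-Schmidt without normalisation: row \<open>s\<close> is projected out of all
  unprocessed rows, which preserves the determinant and shortens rows. Processed rows are kept
  orthogonal to all of \<open>S\<close>, so later steps, which add multiples of rows orthogonal to
  them, do no harm.\<close>

lemma orthogonalise_rows:
  fixes A :: "'i \<Rightarrow> 'i \<Rightarrow> complex"
  assumes S: "finite S" and T: "finite T" "T \<subseteq> S"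
  shows "\<exists>B. set_det S B = set_det S A \<and>
    (\<forall>i\<in>S. (\<Sum>k\<in>S. (norm (B i k))\<^sup>2) \<le> (\<Sum>k\<in>S. (norm (A i k))\<^sup>2)) \<and>
    (\<forall>i\<in>T. \<forall>j\<in>S. i \<noteq> j \<longrightarrow> (\<Sum>k\<in>S. B i k * cnj (B j k)) = 0)"
  using T
proof (induction T rule: finite_induct)
  case empty
  show ?case by (intro exI [of _ A]) auto
next
  case (insert s T)
  then obtain B where B: "set_det S B = set_det S A"
    "\<And>i. i \<in> S \<Longrightarrow> (\<Sum>k\<in>S. (norm (B i k))\<^sup>2) \<le> (\<Sum>k\<in>S. (norm (A i k))\<^sup>2)"
    "\<And>i j. i \<in> T \<Longrightarrow> j \<in> S \<Longrightarrow> i \<noteq> j \<Longrightarrow> (\<Sum>k\<in>S. B i k * cnj (B j k)) = 0"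
    by auto
  define ip where "ip f g = (\<Sum>k\<in>S. f k * cnj (g k))" for f g :: "'i \<Rightarrow> complex"
  have ip_add: "ip f (\<lambda>k. g k + c * h k) = ip f g + cnj c * ip f h"
    "ip (\<lambda>k. g k + c * h k) f = ip g f + c * ip h f" for f g h c
    by (simp_all add: ip_def sum.distrib sum_distrib_left algebra_simps)
  have ip_cnj: "cnj (ip f g) = ip g f" for f g by (simp add: ip_def mult.commute)
  have ip_norm: "ip f f = of_real (\<Sum>k\<in>S. (norm (f k))\<^sup>2)" for f
    by (simp only: ip_def complex_norm_square of_real_sum)
  have ip0: "ip f g = 0" if "ip f f = 0" for f g
  proof -
    have "(\<Sum>k\<in>S. (norm (f k))\<^sup>2) = 0" using that unfolding ip_norm of_real_eq_0_iff .
    hence "\<forall>k\<in>S. f k = 0" using S by (subst (asm) sum_nonneg_eq_0_iff) auto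
    thus ?thesis by (simp add: ip_def)
  qed
  define U where "U = S - T - {s}"
  \<comment> \<open>If row \<open>s\<close> vanishes on \<open>S\<close>, division by zero gives the
    coefficient 0, and every row is already orthogonal to it by \<open>ip0\<close>.\<close>
  define c where "c i = - ip (B i) (B s) / ip (B s) (B s)" for i
  define C where "C = (\<lambda>i k. if i \<in> U then B i k + c i * B s k else B i k)"
  have CU: "C i = (\<lambda>k. B i k + c i * B s k)" if "i \<in> U" for i using that by (simp add: C_def)
  have CnU: "C i = B i" if "i \<notin> U" for i using that by (simp add: C_def)
  have orth_T: "ip (B i) (B j) = 0" if "i \<in> T" "j \<in> S" "i \<noteq> j" for i j
    using B(3) [OF that] by (simp add: ip_def)
  have orth_s: "ip (C i) (B s) = 0" if "i \<in> U" for i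
  proof (cases "ip (B s) (B s) = 0")
    case True
    hence "ip (B i) (B s) = 0" by (metis ip0 ip_cnj complex_cnj_zero)
    thus ?thesis using True unfolding CU [OF that] ip_add by simp
  next
    case False
    thus ?thesis unfolding CU [OF that] ip_add by (simp add: c_def)
  qed
  have s: "s \<in> S" "s \<notin> U" using insert.prems by (auto simp: U_def)
  show ?case
  proof (intro exI [of _ C] conjI ballI impI)
    show "set_det S C = set_det S A"
      unfolding C_def B(1) [symmetric] using S s by (intro set_det_add_rows) (auto simp: U_def)
  next
    fix i assume i: "i \<in> S"
    have "(\<Sum>k\<in>S. (norm (C i k))\<^sup>2) \<le> (\<Sum>k\<in>S. (norm (B i k))\<^sup>2)"
    proof (cases "i \<in> U")
      case True
      have o: "ip (C i) (B s) = 0" by (rule orth_s [OF True])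
      have o': "ip (B s) (C i) = 0" using arg_cong [OF o, of cnj] by (simp only: ip_cnj complex_cnj_zero)
      \<comment> \<open>Pythagoras: \<open>B i\<close> is \<open>C i\<close> plus a multiple of
        \<open>B s\<close> orthogonal to it.\<close>
      have "B i = (\<lambda>k. C i k + (- c i) * B s k)" using True by (simp add: CU)
      hence "ip (B i) (B i) = ip (\<lambda>k. C i k + (- c i) * B s k) (\<lambda>k. C i k + (- c i) * B s k)"
        by (simp only:)
      also have "\<dots> = ip (C i) (C i) + c i * cnj (c i) * ip (B s) (B s)"
        unfolding ip_add o o' by simp
      finally have "(\<Sum>k\<in>S. (norm (B i k))\<^sup>2) =
          (\<Sum>k\<in>S. (norm (C i k))\<^sup>2) + (norm (c i))\<^sup>2 * (\<Sum>k\<in>S. (norm (B s k))\<^sup>2)"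
        unfolding ip_norm complex_norm_square [symmetric] of_real_mult [symmetric]
          of_real_add [symmetric] of_real_eq_iff .
      moreover have "(norm (c i))\<^sup>2 * (\<Sum>k\<in>S. (norm (B s k))\<^sup>2) \<ge> 0"
        by (intro mult_nonneg_nonneg sum_nonneg) auto
      ultimately show ?thesis by linarith
    qed (simp add: CnU)
    thus "(\<Sum>k\<in>S. (norm (C i k))\<^sup>2) \<le> (\<Sum>k\<in>S. (norm (A i k))\<^sup>2)" using B(2) [OF i] by linarith
  next
    fix i j assume ij: "i \<in> insert s T" "j \<in> S" "i \<noteq> j"
    have iU: "i \<notin> U" using ij by (auto simp: U_def)
    have is_T: "ip (B i) (B s) = 0" if "i \<in> T" using that s insert.hyps by (intro orth_T) auto
    have "ip (B i) (C j) = 0"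
    proof (cases "j \<in> U")
      case True
      show ?thesis
      proof (cases "i = s")
        case True
        thus ?thesis using arg_cong [OF orth_s [OF \<open>j \<in> U\<close>], of cnj]
          by (simp only: ip_cnj complex_cnj_zero)
      next
        case False
        thus ?thesis using ij \<open>j \<in> U\<close> is_T orth_T [of i j] by (simp add: CU ip_add)
      qed
    next
      case False
      show ?thesis
      proof (cases "i \<in> T")
        case True
        thus ?thesis using ij False by (simp add: CnU orth_T)
      next
        case F: False
        hence "i = s" "j \<in> T" using ij False by (auto simp: U_def)
        hence "ip (B j) (B i) = 0" using s ij by (intro orth_T) auto
        hence "ip (B i) (B j) = 0" using arg_cong [of _ _ cnj] by (metis ip_cnj complex_cnj_zero)
        thus ?thesis using False by (simp only: CnU not_False_eq_True)
      qed
    qed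
    thus "(\<Sum>k\<in>S. C i k * cnj (C j k)) = 0" using iU by (simp add: CnU ip_def)
  qed
qed

theorem hadamard_inequality:
  fixes A :: "'i \<Rightarrow> 'i \<Rightarrow> complex"
  assumes S: "finite S"
  shows "(norm (set_det S A))\<^sup>2 \<le> (\<Prod>i\<in>S. \<Sum>k\<in>S. (norm (A i k))\<^sup>2)"
proof -
  obtain B where B: "set_det S B = set_det S A"
    "\<And>i. i \<in> S \<Longrightarrow> (\<Sum>k\<in>S. (norm (B i k))\<^sup>2) \<le> (\<Sum>k\<in>S. (norm (A i k))\<^sup>2)"
    "\<And>i j. i \<in> S \<Longrightarrow> j \<in> S \<Longrightarrow> i \<noteq> j \<Longrightarrow> (\<Sum>k\<in>S. B i k * cnj (B j k)) = 0"
    using orthogonalise_rows [OF S S] by blast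
  have "(norm (set_det S B))\<^sup>2 = (\<Prod>i\<in>S. \<Sum>k\<in>S. (norm (B i k))\<^sup>2)"
    using S B(3) by (rule norm_set_det_orthogonal_rows)
  also have "\<dots> \<le> (\<Prod>i\<in>S. \<Sum>k\<in>S. (norm (A i k))\<^sup>2)"
    using B(2) by (intro prod_mono conjI sum_nonneg) auto
  finally show ?thesis using B(1) by simp
qed

section \<open>Extracting the transversal coefficient\<close>

text \<open>If \<open>q\<close> does not divide \<open>e\<close>, multiplication by a primitive root
  \<zeta> permutes the roots but scales the sum by \<open>\<zeta> ^ e\<close>, which is not
  1.\<close>

lemma sum_powers_roots_unity:
  assumes q: "q > 0"
  shows "(\<Sum>z | z ^ q = 1. z ^ e) = (if q dvd e then of_nat q else (0::complex))"
proof (cases "q dvd e")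
  case True
  then obtain m where "e = q * m" by blast
  hence "(\<Sum>z | z ^ q = (1::complex). z ^ e) = (\<Sum>z | z ^ q = (1::complex). 1)"
    by (intro sum.cong) (auto simp: power_mult)
  thus ?thesis using True q by (simp add: card_roots_unity_eq)
next
  case False
  define \<zeta> where "\<zeta> = cis (2 * pi / real q)"
  have \<zeta>q: "\<zeta> ^ q = 1" using q by (simp add: \<zeta>_def DeMoivre)
  have \<zeta>0: "\<zeta> \<noteq> 0" by (simp add: \<zeta>_def)
  have "\<zeta> ^ e \<noteq> 1"
  proof
    assume *: "\<zeta> ^ e = 1"
    have "\<zeta> ^ e = \<zeta> ^ (q * (e div q) + e mod q)" by simp
    also have "\<dots> = \<zeta> ^ (e mod q)" by (simp only: power_add power_mult \<zeta>q) simp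
    finally have "cis (2 * pi * real (e mod q) / real q) = cis (2 * pi * real 0 / real q)"
      using * by (simp add: \<zeta>_def DeMoivre mult.commute)
    moreover have "inj_on (\<lambda>k. cis (2 * pi * real k / real q)) {..<q}"
      using bij_betw_roots_unity [OF q] by (simp add: bij_betw_def)
    ultimately have "e mod q = 0" using q by (auto simp: inj_on_def)
    thus False using False by auto
  qed
  moreover have "(\<Sum>z | z ^ q = (1::complex). z ^ e) = \<zeta> ^ e * (\<Sum>z | z ^ q = (1::complex). z ^ e)"
  proof -
    have "(\<Sum>z | z ^ q = (1::complex). z ^ e) = (\<Sum>z | z ^ q = (1::complex). (\<zeta> * z) ^ e)"
      using \<zeta>q \<zeta>0
      by (intro sum.reindex_bij_witness [of _ "\<lambda>z. \<zeta> * z" "\<lambda>z. z / \<zeta>"])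
        (auto simp: power_mult_distrib power_divide)
    thus ?thesis by (simp only: power_mult_distrib sum_distrib_left [symmetric])
  qed
  ultimately show ?thesis using False by simp
qed

lemma transversal_sum_eq_graphs:
  assumes "finite V" "finite K"
  shows "(\<Sum>T \<in> {T \<in> Pow (V \<times> K). \<forall>v\<in>V. card {s \<in> T. fst s = v} = 1}. f T)
    = (\<Sum>i \<in> V \<rightarrow>\<^sub>E K. f ((\<lambda>v. (v, i v)) ` V))"
proof (rule sym, intro sum.reindex_bij_witness
    [of _ "\<lambda>T. \<lambda>v\<in>V. THE g. (v, g) \<in> T" "\<lambda>i. (\<lambda>v. (v, i v)) ` V"])
  fix i assume i: "i \<in> V \<rightarrow>\<^sub>E K"
  have "(THE g. (v, g) \<in> (\<lambda>v. (v, i v)) ` V) = i v" if "v \<in> V" for v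
    using that by (intro the_equality) auto
  thus "(\<lambda>v\<in>V. THE g. (v, g) \<in> (\<lambda>v. (v, i v)) ` V) = i"
    using i by (auto simp: fun_eq_iff restrict_def PiE_def extensional_def)
  have "{s \<in> (\<lambda>v. (v, i v)) ` V. fst s = v} = {(v, i v)}" if "v \<in> V" for v
    using that by auto
  thus "(\<lambda>v. (v, i v)) ` V \<in> {T \<in> Pow (V \<times> K). \<forall>v\<in>V. card {s \<in> T. fst s = v} = 1}"
    using i by auto
next
  fix T assume T: "T \<in> {T \<in> Pow (V \<times> K). \<forall>v\<in>V. card {s \<in> T. fst s = v} = 1}"
  have "\<exists>!g. (v, g) \<in> T" if v: "v \<in> V" for v
  proof -
    have "card {s \<in> T. fst s = v} = 1" using T v by blast
    then obtain s where s: "{s \<in> T. fst s = v} = {s}" by (auto simp: card_1_singleton_iff)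
    hence "s \<in> T" "fst s = v" by blast+
    hence "(v, snd s) \<in> T" by (metis prod.collapse)
    moreover have "g = snd s" if "(v, g) \<in> T" for g
    proof -
      have "(v, g) \<in> {s \<in> T. fst s = v}" using that by simp
      hence "(v, g) = s" unfolding s by (rule singletonD)
      thus ?thesis by (metis snd_conv)
    qed
    ultimately show ?thesis by blast
  qed
  note ex1 = this
  have mem: "(v, THE g. (v, g) \<in> T) \<in> T" if "v \<in> V" for v
    using theI' [OF ex1 [OF that]] .
  show "(\<lambda>v. (v, (\<lambda>v\<in>V. THE g. (v, g) \<in> T) v)) ` V = T"
  proof (intro equalityI subsetI)
    fix s assume "s \<in> (\<lambda>v. (v, (\<lambda>v\<in>V. THE g. (v, g) \<in> T) v)) ` V"
    then obtain v where "v \<in> V" "s = (v, THE g. (v, g) \<in> T)" by auto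
    thus "s \<in> T" using mem by (simp only:)
  next
    fix s assume s: "s \<in> T"
    hence V: "fst s \<in> V" using T by auto
    moreover have "snd s = (THE g. (fst s, g) \<in> T)"
      using the1_equality [OF ex1 [OF V], of "snd s"] s by simp
    ultimately have "s = (fst s, (\<lambda>v\<in>V. THE g. (v, g) \<in> T) (fst s))"
      by (simp add: prod_eq_iff)
    thus "s \<in> (\<lambda>v. (v, (\<lambda>v\<in>V. THE g. (v, g) \<in> T) v)) ` V"
      using V by (rule image_eqI)
  qed
  have "(THE g. (v, g) \<in> T) \<in> K" if "v \<in> V" for v
    using mem [OF that] T by blast
  thus "(\<lambda>v\<in>V. THE g. (v, g) \<in> T) \<in> V \<rightarrow>\<^sub>E K" by auto
qed auto

text \<open>A discrete Fourier extraction of the coefficient of the product of all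
  \<open>x v\<close>. On \<open>q\<close>-th roots of unity with \<open>q = card K + 1\<close>, the
  weight \<open>x v ^ card K\<close> is the inverse of \<open>x v\<close>, so of the principal
  minors only those meeting each fibre exactly once survive the sum.\<close>

lemma average_set_det_transversals:
  fixes B :: "'v \<times> 'k \<Rightarrow> 'v \<times> 'k \<Rightarrow> complex"
  assumes V: "finite V" and K: "finite K" "K \<noteq> {}"
  defines "q \<equiv> Suc (card K)"
  defines "R \<equiv> {z::complex. z ^ q = 1}"
  shows "(\<Sum>x \<in> V \<rightarrow>\<^sub>E R. (\<Prod>v\<in>V. x v ^ card K) *
      set_det (V \<times> K) (\<lambda>s t. of_bool (s = t) + c * x (fst s) * B s t))
    = (of_nat q * c) ^ card V * (\<Sum>i \<in> V \<rightarrow>\<^sub>E K. set_det V (\<lambda>u v. B (u, i u) (v, i v)))"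
proof -
  let ?S = "V \<times> K"
  define n where "n T v = card {s \<in> T. fst s = v}" for T :: "('v \<times> 'k) set" and v
  have S: "finite ?S" using V K by simp
  have R: "finite R" unfolding R_def q_def by (rule finite_roots_unity) simp
  have mono: "(\<Prod>v\<in>V. x v ^ card K) * (\<Prod>s\<in>T. c * x (fst s)) = c ^ card T * (\<Prod>v\<in>V. x v ^ (card K + n T v))"
    if "T \<in> Pow ?S" for T and x :: "'v \<Rightarrow> complex"
  proof -
    have fT: "finite T" using that S by (auto intro: finite_subset)
    have "(\<Prod>s\<in>T. x (fst s)) = (\<Prod>v\<in>V. \<Prod>s\<in>{s \<in> T. fst s = v}. x (fst s))"
      using that V fT by (intro prod.group [symmetric]) auto
    also have "\<dots> = (\<Prod>v\<in>V. x v ^ n T v)"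
      by (intro prod.cong refl) (simp add: n_def)
    finally show ?thesis by (simp add: prod.distrib power_add mult_ac)
  qed
  have avg: "(\<Sum>x \<in> V \<rightarrow>\<^sub>E R. \<Prod>v\<in>V. x v ^ (card K + n T v)) = (if \<forall>v\<in>V. n T v = 1 then of_nat q ^ card V else 0)"
    if T: "T \<in> Pow ?S" for T
  proof -
    have "(\<Sum>x \<in> V \<rightarrow>\<^sub>E R. \<Prod>v\<in>V. x v ^ (card K + n T v)) = (\<Prod>v\<in>V. \<Sum>z\<in>R. z ^ (card K + n T v))"
      using V R by (subst prod_sum_PiE) auto
    also have "\<dots> = (\<Prod>v\<in>V. if n T v = 1 then of_nat q else 0)"
    proof (intro prod.cong refl)
      fix v assume "v \<in> V"
      have "n T v \<le> card ({v} \<times> K)"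
        unfolding n_def using T K by (intro card_mono) auto
      hence le: "n T v \<le> card K" by (simp only: card_cartesian_product_singleton)
      have "card K > 0" using K by (simp add: card_gt_0_iff)
      \<comment> \<open>The exponent lies between \<open>q - 1\<close> and \<open>2 * q - 2\<close>
        and is positive, so \<open>q\<close> is the only possible multiple.\<close>
      hence "q dvd card K + n T v \<longleftrightarrow> n T v = 1"
      proof (intro iffI)
        assume "q dvd card K + n T v"
        then obtain m where m: "card K + n T v = q * m" by blast
        have "m \<noteq> 0" using m \<open>card K > 0\<close> by (intro notI) simp
        moreover have "m < 2"
        proof (rule ccontr)
          assume "\<not> m < 2"
          hence "q * 2 \<le> q * m" by simp
          thus False using m le by (simp add: q_def)
        qed
        ultimately have "m = 1" by simp
        thus "n T v = 1" using m by (simp add: q_def)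
      qed (simp add: q_def)
      thus "(\<Sum>z\<in>R. z ^ (card K + n T v)) = (if n T v = 1 then of_nat q else 0)"
        unfolding R_def by (subst sum_powers_roots_unity) (auto simp: q_def)
    qed
    also have "\<dots> = (if \<forall>v\<in>V. n T v = 1 then of_nat q ^ card V else 0)"
      using V by (auto intro: prod_zero)
    finally show ?thesis .
  qed
  have "(\<Sum>x \<in> V \<rightarrow>\<^sub>E R. (\<Prod>v\<in>V. x v ^ card K) *
      set_det ?S (\<lambda>s t. of_bool (s = t) + c * x (fst s) * B s t))
    = (\<Sum>x \<in> V \<rightarrow>\<^sub>E R. \<Sum>T\<in>Pow ?S. c ^ card T * (\<Prod>v\<in>V. x v ^ (card K + n T v)) * set_det T B)"
    unfolding set_det_add_diagonal [OF S] sum_distrib_left mult.assoc [symmetric]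
    by (intro sum.cong refl) (simp only: mono)
  also have "\<dots> = (\<Sum>T\<in>Pow ?S. c ^ card T * (\<Sum>x \<in> V \<rightarrow>\<^sub>E R. \<Prod>v\<in>V. x v ^ (card K + n T v)) * set_det T B)"
    by (subst sum.swap) (simp only: sum_distrib_left sum_distrib_right)
  also have "\<dots> = (\<Sum>T\<in>Pow ?S. if \<forall>v\<in>V. n T v = 1 then c ^ card T * of_nat q ^ card V * set_det T B else 0)"
    by (intro sum.cong refl) (simp add: avg)
  also have "\<dots> = (\<Sum>T\<in>{T \<in> Pow ?S. \<forall>v\<in>V. n T v = 1}. c ^ card T * of_nat q ^ card V * set_det T B)"
    using S by (intro sum.inter_filter [symmetric]) simp
  also have "\<dots> = (\<Sum>i \<in> V \<rightarrow>\<^sub>E K. c ^ card ((\<lambda>v. (v, i v)) ` V) * of_nat q ^ card V * set_det ((\<lambda>v. (v, i v)) ` V) B)"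
    unfolding n_def by (rule transversal_sum_eq_graphs [OF V K(1)])
  also have "\<dots> = (\<Sum>i \<in> V \<rightarrow>\<^sub>E K. (of_nat q * c) ^ card V * set_det V (\<lambda>u v. B (u, i u) (v, i v)))"
  proof (intro sum.cong refl)
    fix i :: "'v \<Rightarrow> 'k"
    have inj: "inj_on (\<lambda>v. (v, i v)) V" by (auto simp: inj_on_def)
    show "c ^ card ((\<lambda>v. (v, i v)) ` V) * of_nat q ^ card V * set_det ((\<lambda>v. (v, i v)) ` V) B
        = (of_nat q * c) ^ card V * set_det V (\<lambda>u v. B (u, i u) (v, i v))"
      unfolding set_det_image [OF inj V] card_image [OF inj] by (simp add: power_mult_distrib)
  qed
  finally show ?thesis by (simp only: sum_distrib_left)
qed

text \<open>A coefficient is at most the maximum of the determinant over the sampled points, which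
  Hadamard's inequality bounds. The zero diagonal of \<open>B\<close> removes cross terms, so each
  row has squared norm exactly \<open>1 + r\<^sup>2 * \<beta>\<close>.\<close>

lemma transversal_set_det_bound:
  fixes B :: "'v \<times> 'k \<Rightarrow> 'v \<times> 'k \<Rightarrow> complex"
  assumes V: "finite V" and K: "finite K" "K \<noteq> {}" and r: "r > 0"
    and diag: "\<And>s. s \<in> V \<times> K \<Longrightarrow> B s s = 0"
    and rows: "\<And>s. s \<in> V \<times> K \<Longrightarrow> (\<Sum>t\<in>V \<times> K. (norm (B s t))\<^sup>2) = \<beta>"
  shows "(r ^ card V * norm (\<Sum>i \<in> V \<rightarrow>\<^sub>E K. set_det V (\<lambda>u v. B (u, i u) (v, i v))))\<^sup>2
    \<le> (1 + r\<^sup>2 * \<beta>) ^ (card V * card K)"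
proof -
  let ?S = "V \<times> K"
  define q where "q = Suc (card K)"
  define R where "R = {z::complex. z ^ q = 1}"
  define P where "P x = set_det ?S (\<lambda>s t. of_bool (s = t) + of_real r * x (fst s) * B s t)" for x
  define M where "M = sqrt ((1 + r\<^sup>2 * \<beta>) ^ (card V * card K))"
  have S: "finite ?S" using V K by simp
  have norm_R: "norm z = 1" if "z \<in> R" for z
  proof -
    have "norm z ^ q = 1" using that by (simp add: R_def norm_power [symmetric])
    hence "norm z ^ q = 1 ^ q" by simp
    thus ?thesis by (rule power_eq_imp_eq_base) (simp_all add: q_def)
  qed
  have card_R: "card R = q" unfolding R_def by (rule card_roots_unity_eq) (simp add: q_def)
  have bound: "norm (P x) \<le> M" if x: "x \<in> V \<rightarrow>\<^sub>E R" for x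
  proof -
    have "(norm (P x))\<^sup>2 \<le> (\<Prod>s\<in>?S. \<Sum>t\<in>?S. (norm (of_bool (s = t) + of_real r * x (fst s) * B s t))\<^sup>2)"
      unfolding P_def by (rule hadamard_inequality [OF S])
    also have "\<dots> = (\<Prod>s\<in>?S. 1 + r\<^sup>2 * \<beta>)"
    proof (intro prod.cong refl)
      fix s assume s: "s \<in> ?S"
      have nx: "norm (x (fst s)) = 1" using x s by (intro norm_R) auto
      have "(\<Sum>t\<in>?S. (norm (of_bool (s = t) + of_real r * x (fst s) * B s t))\<^sup>2)
          = (\<Sum>t\<in>?S. of_bool (s = t) + r\<^sup>2 * (norm (B s t))\<^sup>2)"
        using diag [OF s] nx by (intro sum.cong refl) (auto simp: norm_mult power_mult_distrib)
      also have "\<dots> = 1 + r\<^sup>2 * \<beta>"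
        using S s rows [OF s] by (simp add: sum.distrib sum_distrib_left [symmetric] of_bool_def)
      finally show "(\<Sum>t\<in>?S. (norm (of_bool (s = t) + of_real r * x (fst s) * B s t))\<^sup>2) = 1 + r\<^sup>2 * \<beta>" .
    qed
    also have "\<dots> = (1 + r\<^sup>2 * \<beta>) ^ (card V * card K)" by (simp add: card_cartesian_product)
    finally show ?thesis unfolding M_def by (rule real_le_rsqrt)
  qed
  have "norm ((of_nat q * of_real r) ^ card V * (\<Sum>i \<in> V \<rightarrow>\<^sub>E K. set_det V (\<lambda>u v. B (u, i u) (v, i v))))
      = norm (\<Sum>x \<in> V \<rightarrow>\<^sub>E R. (\<Prod>v\<in>V. x v ^ card K) * P x)"
    using average_set_det_transversals [OF V K, of "of_real r" B] by (simp only: P_def R_def q_def)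
  also have "\<dots> \<le> (\<Sum>x \<in> V \<rightarrow>\<^sub>E R. M)"
  proof (rule sum_norm_le)
    fix x assume x: "x \<in> V \<rightarrow>\<^sub>E R"
    have "(\<Prod>v\<in>V. norm (x v) ^ card K) = 1"
      by (intro prod.neutral ballI) (simp add: norm_R [OF PiE_mem [OF x]])
    thus "norm ((\<Prod>v\<in>V. x v ^ card K) * P x) \<le> M"
      using bound [OF x] by (simp add: norm_mult prod_norm [symmetric] norm_power)
  qed
  also have "\<dots> = real q ^ card V * M"
    using V by (simp add: card_PiE card_R)
  finally have "real q ^ card V * (r ^ card V * norm (\<Sum>i \<in> V \<rightarrow>\<^sub>E K. set_det V (\<lambda>u v. B (u, i u) (v, i v))))
      \<le> real q ^ card V * M"
    using r by (simp add: norm_mult norm_power power_mult_distrib mult.assoc)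
  hence le: "r ^ card V * norm (\<Sum>i \<in> V \<rightarrow>\<^sub>E K. set_det V (\<lambda>u v. B (u, i u) (v, i v))) \<le> M"
    by (simp add: q_def)
  have "0 \<le> r ^ card V * norm (\<Sum>i \<in> V \<rightarrow>\<^sub>E K. set_det V (\<lambda>u v. B (u, i u) (v, i v)))"
    using r by simp
  hence "(r ^ card V * norm (\<Sum>i \<in> V \<rightarrow>\<^sub>E K. set_det V (\<lambda>u v. B (u, i u) (v, i v))))\<^sup>2 \<le> M\<^sup>2"
    using le by (intro power_mono)
  \<comment> \<open>For empty \<open>V\<close> the sign of \<beta> is unknown, but the exponent is
    0; otherwise \<beta> is a sum of squares.\<close>
  moreover have "M\<^sup>2 = (1 + r\<^sup>2 * \<beta>) ^ (card V * card K)"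
  proof (cases "V = {}")
    case False
    then obtain v where "v \<in> V" by blast
    moreover obtain g where "g \<in> K" using K by blast
    ultimately have "\<beta> = (\<Sum>t\<in>?S. (norm (B (v, g) t))\<^sup>2)" using rows [of "(v, g)"] by simp
    hence "\<beta> \<ge> 0" by (simp add: sum_nonneg)
    thus ?thesis unfolding M_def by (simp add: add_nonneg_nonneg)
  qed (simp add: M_def)
  ultimately show ?thesis by simp
qed

section \<open>Cycle covers and the reduced regular representation\<close>

lemma sum_PiE_insert:
  assumes "u \<notin> S"
  shows "(\<Sum>i \<in> insert u S \<rightarrow>\<^sub>E K. f i) = (\<Sum>y\<in>K. \<Sum>i \<in> S \<rightarrow>\<^sub>E K. f (i(u := y)))"
proof -
  have "(\<Sum>i \<in> insert u S \<rightarrow>\<^sub>E K. f i) = (\<Sum>(y, i) \<in> K \<times> (S \<rightarrow>\<^sub>E K). f (i(u := y)))"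
    unfolding PiE_insert_eq using inj_combinator [OF assms, of "\<lambda>_. K"]
    by (subst sum.reindex) (auto simp: case_prod_unfold intro!: sum.cong)
  thus ?thesis by (simp add: sum.cartesian_product)
qed

lemma sum_PiE_Un_disjoint:
  fixes f g :: "('a \<Rightarrow> 'b) \<Rightarrow> 'c::comm_semiring_0"
  assumes "A \<inter> B = {}"
    and f: "\<And>i j. (\<And>x. x \<in> A \<Longrightarrow> i x = j x) \<Longrightarrow> f i = f j"
    and g: "\<And>i j. (\<And>x. x \<in> B \<Longrightarrow> i x = j x) \<Longrightarrow> g i = g j"
  shows "(\<Sum>i \<in> A \<union> B \<rightarrow>\<^sub>E K. f i * g i) = (\<Sum>i \<in> A \<rightarrow>\<^sub>E K. f i) * (\<Sum>i \<in> B \<rightarrow>\<^sub>E K. g i)"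
proof -
  let ?m = "\<lambda>(i, j) x. if x \<in> A then i x else j x"
  have "(\<Sum>i \<in> A \<union> B \<rightarrow>\<^sub>E K. f i * g i) = (\<Sum>p \<in> (A \<rightarrow>\<^sub>E K) \<times> (B \<rightarrow>\<^sub>E K). f (fst p) * g (snd p))"
  proof (intro sum.reindex_bij_witness [of _ ?m "\<lambda>i. (restrict i A, restrict i B)"])
    fix i assume i: "i \<in> A \<union> B \<rightarrow>\<^sub>E K"
    show "?m (restrict i A, restrict i B) = i"
      using i by (auto simp: fun_eq_iff PiE_def extensional_def)
    show "(restrict i A, restrict i B) \<in> (A \<rightarrow>\<^sub>E K) \<times> (B \<rightarrow>\<^sub>E K)" using i by auto
    show "f (fst (restrict i A, restrict i B)) * g (snd (restrict i A, restrict i B)) = f i * g i"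
      by (intro arg_cong2 [where f = "(*)"] f g) auto
  next
    fix p assume p: "p \<in> (A \<rightarrow>\<^sub>E K) \<times> (B \<rightarrow>\<^sub>E K)"
    show "(restrict (?m p) A, restrict (?m p) B) = p"
      using p assms(1) by (cases p) (auto simp: fun_eq_iff PiE_def extensional_def)
    show "?m p \<in> A \<union> B \<rightarrow>\<^sub>E K"
      using p by (cases p) (auto simp: PiE_def extensional_def)
  qed
  thus ?thesis by (simp add: sum_product sum.cartesian_product case_prod_unfold)
qed

section \<open>The reduced regular representation and its traces along cycles\<close>

text \<open>Subtracting the constant amounts to composing the permutation matrix of right
  translation with the projection that kills constant vectors. The identity of a finite group is
  thus sent to that projection, not to the identity matrix.\<close>

definition reduced_regular_rep :: "('g, 'm) monoid_scheme \<Rightarrow> 'g \<Rightarrow> 'g \<Rightarrow> 'g \<Rightarrow> complex" where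
  "reduced_regular_rep G a g h = of_bool (h = g \<otimes>\<^bsub>G\<^esub> a) - 1 / of_nat (order G)"

context group
begin

text \<open>With permutation matrices P and the all-ones matrix J of size k, PJ = JP = J and JJ =
  kJ, so the four terms of the product collapse.\<close>

lemma reduced_regular_rep_mult:
  assumes fin: "finite (carrier G)" and "a \<in> carrier G" "b \<in> carrier G" "g \<in> carrier G" "h \<in> carrier G"
  shows "(\<Sum>x\<in>carrier G. reduced_regular_rep G a g x * reduced_regular_rep G b x h)
    = reduced_regular_rep G (a \<otimes> b) g h"
proof -
  let ?k = "of_nat (order G) :: complex"
  have k: "?k \<noteq> 0" using fin order_gt_0_iff_finite by (metis less_irrefl of_nat_eq_0_iff)
  have iff: "h = x \<otimes> b \<longleftrightarrow> x = h \<otimes> inv b" if "x \<in> carrier G" for x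
    using assms that by (metis inv_solve_right)
  have "(\<Sum>x\<in>carrier G. reduced_regular_rep G a g x * reduced_regular_rep G b x h)
      = (\<Sum>x\<in>carrier G. (if x = g \<otimes> a then of_bool (h = x \<otimes> b) else 0)
          - (if x = g \<otimes> a then 1 / ?k else 0) - (if x = h \<otimes> inv b then 1 / ?k else 0) + 1 / ?k\<^sup>2)"
  proof (intro sum.cong refl)
    fix x assume x: "x \<in> carrier G"
    show "reduced_regular_rep G a g x * reduced_regular_rep G b x h =
        (if x = g \<otimes> a then of_bool (h = x \<otimes> b) else 0)
          - (if x = g \<otimes> a then 1 / ?k else 0) - (if x = h \<otimes> inv b then 1 / ?k else 0) + 1 / ?k\<^sup>2"
      unfolding reduced_regular_rep_def iff [OF x, symmetric]
      by (cases "x = g \<otimes> a"; cases "h = x \<otimes> b") (simp_all add: algebra_simps power2_eq_square)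
  qed
  also have "\<dots> = of_bool (h = g \<otimes> a \<otimes> b) - 1 / ?k - 1 / ?k + of_nat (card (carrier G)) * (1 / ?k\<^sup>2)"
    using assms by (simp add: sum.distrib sum_subtractf)
  also have "\<dots> = reduced_regular_rep G (a \<otimes> b) g h"
    using assms k by (simp add: reduced_regular_rep_def order_def m_assoc power2_eq_square field_simps)
  finally show ?thesis .
qed

text \<open>Translation by a non-identity element has no fixed point, so every diagonal entry is
  \<open>- 1 / of_nat (order G)\<close>.\<close>

lemma trace_reduced_regular_rep:
  assumes fin: "finite (carrier G)" and a: "a \<in> carrier G" "a \<noteq> \<one>"
  shows "(\<Sum>g\<in>carrier G. reduced_regular_rep G a g g) = -1"
proof -
  have "order G > 0" using fin order_gt_0_iff_finite by simp
  moreover have "(\<Sum>g\<in>carrier G. reduced_regular_rep G a g g) = (\<Sum>g\<in>carrier G. - 1 / of_nat (order G))"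
    using a by (intro sum.cong refl) (auto simp: reduced_regular_rep_def)
  ultimately show ?thesis by (simp add: order_def)
qed

lemma row_norm_reduced_regular_rep:
  assumes fin: "finite (carrier G)" and a: "a \<in> carrier G" "g \<in> carrier G"
  shows "(\<Sum>h\<in>carrier G. (norm (reduced_regular_rep G a g h))\<^sup>2) = 1 - 1 / real (order G)"
proof -
  let ?k = "real (order G)"
  have k: "?k > 0" using fin order_gt_0_iff_finite by simp
  have "(norm (reduced_regular_rep G a g h))\<^sup>2 = (if h = g \<otimes> a then 1 - 2 / ?k else 0) + 1 / ?k\<^sup>2" for h
  proof -
    have "reduced_regular_rep G a g h = of_real (of_bool (h = g \<otimes> a) - 1 / ?k)"
      by (simp add: reduced_regular_rep_def)
    hence "(norm (reduced_regular_rep G a g h))\<^sup>2 = (of_bool (h = g \<otimes> a) - 1 / ?k)\<^sup>2"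
      by (simp only: norm_of_real power2_abs)
    thus ?thesis by (simp add: power2_diff power_one_over)
  qed
  hence "(\<Sum>h\<in>carrier G. (norm (reduced_regular_rep G a g h))\<^sup>2) = 1 - 2 / ?k + ?k * (1 / ?k\<^sup>2)"
    using assms by (simp add: sum.distrib order_def)
  thus ?thesis using k by (simp add: power2_eq_square field_simps)
qed

lemma label_product_closed: "w \<in> set p \<rightarrow> carrier G \<Longrightarrow> label_product G w p \<in> carrier G"
  by (induction p) (auto simp: label_product_def)

text \<open>One term of an expanded matrix product along the path \<open>v # us\<close>:
  \<open>i\<close> supplies the intermediate indices, \<open>g\<close> and \<open>h\<close> the
  outer ones. Each label is attached to the tail of its arc.\<close>

fun rep_chain :: "('v \<Rightarrow> 'a) \<Rightarrow> 'v \<Rightarrow> 'v list \<Rightarrow> ('v \<Rightarrow> 'a) \<Rightarrow> 'a \<Rightarrow> 'a \<Rightarrow> complex" where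
  "rep_chain l v [] i g h = reduced_regular_rep G (l v) g h"
| "rep_chain l v (u # us) i g h = reduced_regular_rep G (l v) g (i u) * rep_chain l u us i (i u) h"

lemma rep_chain_cong:
  "(\<And>x. x \<in> set us \<Longrightarrow> i x = j x) \<Longrightarrow> rep_chain l v us i g h = rep_chain l v us j g h"
  by (induction us arbitrary: v g) auto

text \<open>Distinct vertices have independent indices, so the sum is an entry of a matrix product,
  which multiplicativity collapses.\<close>

lemma sum_rep_chain:
  assumes "finite (carrier G)" "distinct us" "l \<in> set (v # us) \<rightarrow> carrier G" "g \<in> carrier G" "h \<in> carrier G"
  shows "(\<Sum>i \<in> set us \<rightarrow>\<^sub>E carrier G. rep_chain l v us i g h) =
    reduced_regular_rep G (label_product G l (v # us)) g h"
  using assms(2-4)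
proof (induction us arbitrary: v g)
  case Nil
  thus ?case by (simp add: PiE_empty_domain label_product_def Pi_def)
next
  case (Cons u us)
  have "(\<Sum>i \<in> set (u # us) \<rightarrow>\<^sub>E carrier G. rep_chain l v (u # us) i g h)
      = (\<Sum>x\<in>carrier G. \<Sum>i \<in> set us \<rightarrow>\<^sub>E carrier G. rep_chain l v (u # us) (i(u := x)) g h)"
    using Cons.prems by (simp only: list.set, subst sum_PiE_insert) auto
  also have "\<dots> = (\<Sum>x\<in>carrier G. reduced_regular_rep G (l v) g x *
      (\<Sum>i \<in> set us \<rightarrow>\<^sub>E carrier G. rep_chain l u us i x h))"
  proof (intro sum.cong refl)
    fix x assume "x \<in> carrier G"
    have "rep_chain l u us (i(u := x)) x h = rep_chain l u us i x h" for i
      using Cons.prems by (intro rep_chain_cong) auto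
    thus "(\<Sum>i \<in> set us \<rightarrow>\<^sub>E carrier G. rep_chain l v (u # us) (i(u := x)) g h) =
      reduced_regular_rep G (l v) g x * (\<Sum>i \<in> set us \<rightarrow>\<^sub>E carrier G. rep_chain l u us i x h)"
      by (simp add: sum_distrib_left)
  qed
  also have "\<dots> = (\<Sum>x\<in>carrier G. reduced_regular_rep G (l v) g x *
      reduced_regular_rep G (label_product G l (u # us)) x h)"
    using Cons.prems by (intro sum.cong refl arg_cong2 [where f = "(*)"] Cons.IH) auto
  also have "\<dots> = reduced_regular_rep G (l v \<otimes> label_product G l (u # us)) g h"
    using Cons.prems assms by (intro reduced_regular_rep_mult label_product_closed) auto
  finally show ?case by (simp add: label_product_def)
qed

lemma prod_eq_rep_chain:
  assumes "distinct (v # us)" "map s (v # us) = us @ [y]"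
  shows "(\<Prod>x\<in>set (v # us). reduced_regular_rep G (l x) (i x) (i (s x))) = rep_chain l v us i (i v) (i y)"
  using assms by (induction us arbitrary: v) auto

text \<open>Summing also over the index of the first vertex closes the chain into the trace of the
  matrix of the cycle's label product.\<close>

lemma sum_prod_cycle:
  assumes fin: "finite (carrier G)" and cs: "distinct cs" "cs \<noteq> []" "map s cs = rotate1 cs"
    and l: "l \<in> set cs \<rightarrow> carrier G" "label_product G l cs \<noteq> \<one>"
  shows "(\<Sum>i \<in> set cs \<rightarrow>\<^sub>E carrier G. \<Prod>x\<in>set cs. reduced_regular_rep G (l x) (i x) (i (s x))) = -1"
proof -
  obtain v us where [simp]: "cs = v # us" using cs(2) by (cases cs) auto
  have "(\<Sum>i \<in> set cs \<rightarrow>\<^sub>E carrier G. \<Prod>x\<in>set cs. reduced_regular_rep G (l x) (i x) (i (s x)))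
      = (\<Sum>i \<in> insert v (set us) \<rightarrow>\<^sub>E carrier G. rep_chain l v us i (i v) (i v))"
    using prod_eq_rep_chain [of v us s v] cs by (simp del: prod.insert)
  also have "\<dots> = (\<Sum>g\<in>carrier G. \<Sum>i \<in> set us \<rightarrow>\<^sub>E carrier G. rep_chain l v us (i(v := g)) g g)"
    using cs by (subst sum_PiE_insert) auto
  also have "\<dots> = (\<Sum>g\<in>carrier G. \<Sum>i \<in> set us \<rightarrow>\<^sub>E carrier G. rep_chain l v us i g g)"
    using cs by (intro sum.cong refl rep_chain_cong) auto
  also have "\<dots> = (\<Sum>g\<in>carrier G. reduced_regular_rep G (label_product G l cs) g g)"
    using fin cs l by (intro sum.cong refl, subst sum_rep_chain) auto
  also have "\<dots> = -1" using fin l by (intro trace_reduced_regular_rep label_product_closed) auto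
  finally show ?thesis .
qed

end

section \<open>Signs and cycle decompositions\<close>

lemma sign_cycle_of_list: "distinct cs \<Longrightarrow> cs \<noteq> [] \<Longrightarrow> sign (cycle_of_list cs) = (- 1) ^ (length cs - 1)"
proof (induction cs rule: cycle_of_list.induct)
  case (1 i j cs)
  have "sign (cycle_of_list (i # j # cs)) = sign (transpose i j) * sign (cycle_of_list (j # cs))"
    unfolding cycle_of_list.simps by (intro sign_compose permutation_swap_id permutation_of_cycle)
  also have "\<dots> = (- 1) ^ (length (i # j # cs) - 1)" using 1 by (simp add: sign_swap_id)
  finally show ?case .
qed auto

lemma cycle_decomp_permutes: "cycle_decomp S p \<Longrightarrow> finite S \<and> p permutes S"
proof (induction rule: cycle_decomp.induct)
  case (comp I p cs)
  have "cycle_of_list cs permutes set cs \<union> I"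
    using cycle_permutes by (rule permutes_subset) simp
  moreover have "p permutes set cs \<union> I"
    using comp.IH [THEN conjunct2] by (rule permutes_subset) simp
  ultimately have "cycle_of_list cs \<circ> p permutes set cs \<union> I"
    by (intro permutes_compose)
  moreover have "finite (set cs \<union> I)" using comp.IH by simp
  ultimately show ?case by (intro conjI)
qed (intro conjI finite.emptyI permutes_id)

text \<open>The sum factors over the cycles. Each contributes -1 as a trace and
  \<open>(- 1) ^ (length cs - 1)\<close> as a sign, together -1 per vertex, independently of the
  cycle type.\<close>

lemma (in group) sum_prod_cycle_decomp:
  assumes fin: "finite (carrier G)" and "cycle_decomp S p" and "l \<in> S \<rightarrow> carrier G"
    and "\<And>cs. distinct cs \<Longrightarrow> cs \<noteq> [] \<Longrightarrow> set cs \<subseteq> S \<Longrightarrow> map p cs = rotate1 cs \<Longrightarrow>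
      label_product G l cs \<noteq> \<one>"
  shows "of_int (sign p) * (\<Sum>i \<in> S \<rightarrow>\<^sub>E carrier G. \<Prod>x\<in>S. reduced_regular_rep G (l x) (i x) (i (p x)))
    = (- 1) ^ card S"
  using assms(2-)
proof (induction rule: cycle_decomp.induct)
  case empty
  thus ?case by (simp add: PiE_empty_domain)
next
  case (comp I p cs)
  let ?c = "cycle_of_list cs"
  have p: "finite I" "p permutes I" using cycle_decomp_permutes [OF comp.hyps(1)] by auto
  \<comment> \<open>The supports are disjoint, so cycles of either factor are cycles of the
    composite and inherit the assumption on label products.\<close>
  have on_I: "(?c \<circ> p) x = p x" if "x \<in> I" for x
    using permutes_in_image [OF p(2), of x] that comp.hyps(3) by (auto intro: id_outside_supp)
  have on_cs: "(?c \<circ> p) x = ?c x" if "x \<in> set cs" for x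
  proof -
    have "x \<notin> I" using that comp.hyps(3) by blast
    thus ?thesis using p(2) by (simp add: permutes_not_in)
  qed
  \<comment> \<open>The decomposition may contain an empty list, which contributes nothing.\<close>
  show ?case
  proof (cases "cs = []")
    case True
    thus ?thesis using comp by simp
  next
    case False
    have map_c: "map ?c cs = rotate1 cs" using cyclic_rotation [OF comp.hyps(2), of 1] by simp
    have IH: "of_int (sign p) * (\<Sum>i \<in> I \<rightarrow>\<^sub>E carrier G. \<Prod>x\<in>I. reduced_regular_rep G (l x) (i x) (i (p x)))
        = (- 1) ^ card I"
    proof (rule comp.IH)
      fix ds assume ds: "distinct ds" "ds \<noteq> []" "set ds \<subseteq> I" "map p ds = rotate1 ds"
      have "map (?c \<circ> p) ds = map p ds" using ds(3) on_I by (intro map_cong) auto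
      hence "map (?c \<circ> p) ds = rotate1 ds" by (simp only: ds(4))
      thus "label_product G l ds \<noteq> \<one>" by (rule comp.prems(2) [OF ds(1,2), rotated]) (use ds in auto)
    qed (use comp.prems in auto)
    have cyc: "(\<Sum>i \<in> set cs \<rightarrow>\<^sub>E carrier G. \<Prod>x\<in>set cs. reduced_regular_rep G (l x) (i x) (i (?c x))) = -1"
    proof (rule sum_prod_cycle [OF fin comp.hyps(2) False map_c])
      have "map (?c \<circ> p) cs = rotate1 cs" using on_cs map_c by (metis map_cong)
      thus "label_product G l cs \<noteq> \<one>" by (rule comp.prems(2) [OF comp.hyps(2) False, rotated]) auto
    qed (use comp.prems in auto)
    have "(\<Sum>i \<in> set cs \<union> I \<rightarrow>\<^sub>E carrier G. \<Prod>x\<in>set cs \<union> I. reduced_regular_rep G (l x) (i x) (i ((?c \<circ> p) x)))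
      = (\<Sum>i \<in> set cs \<union> I \<rightarrow>\<^sub>E carrier G. (\<Prod>x\<in>set cs. reduced_regular_rep G (l x) (i x) (i (?c x))) *
          (\<Prod>x\<in>I. reduced_regular_rep G (l x) (i x) (i (p x))))"
      using p comp.hyps(3) on_I on_cs
      by (intro sum.cong refl, subst prod.union_disjoint) (auto intro!: arg_cong2 [where f = "(*)"] prod.cong)
    also have "\<dots> = (\<Sum>i \<in> set cs \<rightarrow>\<^sub>E carrier G. \<Prod>x\<in>set cs. reduced_regular_rep G (l x) (i x) (i (?c x))) *
        (\<Sum>i \<in> I \<rightarrow>\<^sub>E carrier G. \<Prod>x\<in>I. reduced_regular_rep G (l x) (i x) (i (p x)))"
    proof (rule sum_PiE_Un_disjoint)
      fix i j :: "'c \<Rightarrow> 'a"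
      have cl: "?c x \<in> set cs" if "x \<in> set cs" for x using that cycle_permutes [of cs] by (simp add: permutes_in_image)
      show "(\<Prod>x\<in>set cs. reduced_regular_rep G (l x) (i x) (i (?c x))) = (\<Prod>x\<in>set cs. reduced_regular_rep G (l x) (j x) (j (?c x)))"
        if "\<And>x. x \<in> set cs \<Longrightarrow> i x = j x" using that cl by (intro prod.cong) auto
      show "(\<Prod>x\<in>I. reduced_regular_rep G (l x) (i x) (i (p x))) = (\<Prod>x\<in>I. reduced_regular_rep G (l x) (j x) (j (p x)))"
        if "\<And>x. x \<in> I \<Longrightarrow> i x = j x" using that permutes_in_image [OF p(2)] by (intro prod.cong) auto
    qed (use comp.hyps in auto)
    finally have eq: "(\<Sum>i \<in> set cs \<union> I \<rightarrow>\<^sub>E carrier G. \<Prod>x\<in>set cs \<union> I. reduced_regular_rep G (l x) (i x) (i ((?c \<circ> p) x)))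
      = - (\<Sum>i \<in> I \<rightarrow>\<^sub>E carrier G. \<Prod>x\<in>I. reduced_regular_rep G (l x) (i x) (i (p x)))"
      unfolding cyc by simp
    have "sign (?c \<circ> p) = sign ?c * sign p"
      using p by (intro sign_compose permutation_of_cycle permutes_imp_permutation)
    hence sgn: "complex_of_int (sign (?c \<circ> p)) = - ((- 1) ^ length cs) * of_int (sign p)"
      using sign_cycle_of_list [OF comp.hyps(2) False] False by (cases cs) auto
    have card: "card (set cs \<union> I) = length cs + card I"
      using p comp.hyps by (simp add: card_Un_disjoint distinct_card)
    show ?thesis unfolding eq sgn card power_add IH [symmetric] by simp
  qed
qed

section \<open>Zero-sum cycles\<close>

lemma (in pre_digraph) cas_map_arcs:
  assumes "\<And>x. x \<in> set (v # vs) \<Longrightarrow> tail G (a x) = x \<and> head G (a x) = s x"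
    and "map s (v # vs) = vs @ [y]"
  shows "cas v (map a (v # vs)) y \<and> awalk_verts v (map a (v # vs)) = v # vs @ [y]"
  using assms
proof (induction vs arbitrary: v)
  case (Cons u vs)
  have "cas u (map a (u # vs)) y \<and> awalk_verts u (map a (u # vs)) = u # vs @ [y]"
    using Cons.prems by (intro Cons.IH) auto
  thus ?case using Cons.prems by simp
qed simp

lemma zero_sum_cycle_of_orbit:
  assumes "wf_digraph D" and cs: "distinct cs" "cs \<noteq> []" "map s cs = rotate1 cs"
    and a: "\<And>x. x \<in> set cs \<Longrightarrow> a x \<in> arcs D \<and> tail D (a x) = x \<and> head D (a x) = s x"
    and prod: "label_product \<Gamma> (\<lambda>x. w (a x)) cs = \<one>\<^bsub>\<Gamma>\<^esub>"
  shows "zero_sum_cycle \<Gamma> D w (map a cs)"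
proof -
  interpret wf_digraph D by fact
  obtain v vs where cs_eq: "cs = v # vs" using cs(2) by (cases cs) auto
  have walk: "cas v (map a cs) v \<and> awalk_verts v (map a cs) = v # vs @ [v]"
    unfolding cs_eq using a cs(3) by (intro cas_map_arcs [of v vs a s v]) (auto simp: cs_eq)
  have "a v \<in> arcs D" "tail D (a v) = v" using a by (simp_all add: cs_eq)
  hence "v \<in> verts D" by (metis tail_in_verts)
  hence "awalk v (map a cs) v" using walk a by (auto simp: awalk_def)
  moreover have "distinct (tl (awalk_verts v (map a cs)))"
    using walk cs(1) by (simp add: cs_eq)
  ultimately have "cycle (map a cs)" using cs(2) by (auto simp: cycle_def)
  moreover have "label_product \<Gamma> w (map a cs) = \<one>\<^bsub>\<Gamma>\<^esub>"
    using prod by (simp add: label_product_def o_def)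
  ultimately show ?thesis by (simp add: zero_sum_cycle_def)
qed

text \<open>Without parallel arcs, \<open>head G\<close> is injective on the arcs leaving
  \<open>v\<close>.\<close>

lemma (in digraph) card_out_neighbours:
  "card {u \<in> verts G. \<exists>e\<in>arcs G. tail G e = v \<and> head G e = u} = out_degree G v"
proof -
  have "{u \<in> verts G. \<exists>e\<in>arcs G. tail G e = v \<and> head G e = u} = head G ` out_arcs G v"
    by (auto simp: out_arcs_def)
  moreover have "inj_on (head G) (out_arcs G v)"
    by (intro inj_onI no_multi_arcs) (auto simp: out_arcs_def arc_to_ends_def)
  ultimately show ?thesis by (simp add: card_image out_degree_def)
qed

lemma (in digraph) card_in_neighbours:
  "card {u \<in> verts G. \<exists>e\<in>arcs G. tail G e = u \<and> head G e = v} = in_degree G v"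
proof -
  have "{u \<in> verts G. \<exists>e\<in>arcs G. tail G e = u \<and> head G e = v} = tail G ` in_arcs G v"
    by (auto simp: in_arcs_def)
  moreover have "inj_on (tail G) (in_arcs G v)"
    by (intro inj_onI no_multi_arcs) (auto simp: in_arcs_def arc_to_ends_def)
  ultimately show ?thesis by (simp add: card_image in_degree_def)
qed

lemma one_plus_inverse_power_less_exp:
  assumes "k > 0"
  shows "(1 + 1 / real k) ^ k < exp 1"
proof -
  have "ln (1 + 1 / real k) < 1 / real k" using assms by (intro ln_add_one_self_less_self) simp
  hence "real k * ln (1 + 1 / real k) < 1" using assms by (simp add: field_simps)
  hence "exp (real k * ln (1 + 1 / real k)) < exp 1" by simp
  thus ?thesis using assms by (simp add: exp_of_nat_mult add_pos_pos)
qed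

text \<open>
  The reduced regular representation has character \<open>- 1\<close> off the identity, so a cycle cover
  without zero-sum cycles contributes \<open>(- 1)\<close> to the number of its cycles, and the sign of the
  permutation turns this into \<open>(- 1) ^ card V\<close>.
\<close>

lemma (in group) sum_set_det_eq_permanent:
  fixes E :: "'v \<Rightarrow> 'v \<Rightarrow> bool" and l :: "'v \<Rightarrow> 'v \<Rightarrow> 'a"
  assumes fin: "finite (carrier G)" and V: "finite V"
    and l: "\<And>u v. u \<in> V \<Longrightarrow> v \<in> V \<Longrightarrow> E u v \<Longrightarrow> l u v \<in> carrier G"
    and no: "\<And>cs s. distinct cs \<Longrightarrow> cs \<noteq> [] \<Longrightarrow> set cs \<subseteq> V \<Longrightarrow> map s cs = rotate1 cs \<Longrightarrow>
      (\<And>x. x \<in> set cs \<Longrightarrow> E x (s x)) \<Longrightarrow> label_product G (\<lambda>x. l x (s x)) cs \<noteq> \<one>"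
  shows "(\<Sum>i \<in> V \<rightarrow>\<^sub>E carrier G. set_det V
      (\<lambda>u v. of_bool (E u v) * reduced_regular_rep G (l u v) (i u) (i v)))
    = (- 1) ^ card V * of_real (permanent V (\<lambda>u v. of_bool (E u v)))"
proof -
  let ?t = "\<lambda>p i. \<Prod>v\<in>V. of_bool (E v (p v)) * reduced_regular_rep G (l v (p v)) (i v) (i (p v))"
  have "(\<Sum>i \<in> V \<rightarrow>\<^sub>E carrier G. set_det V
      (\<lambda>u v. of_bool (E u v) * reduced_regular_rep G (l u v) (i u) (i v)))
    = (\<Sum>p | p permutes V. \<Sum>i \<in> V \<rightarrow>\<^sub>E carrier G. of_int (sign p) * ?t p i)"
    unfolding set_det_def by (rule sum.swap)
  also have "\<dots> = (\<Sum>p | p permutes V. (- 1) ^ card V * (\<Prod>v\<in>V. of_bool (E v (p v))))"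
  proof (intro sum.cong refl)
    fix p assume "p \<in> {p. p permutes V}"
    hence p: "p permutes V" by simp
    show "(\<Sum>i \<in> V \<rightarrow>\<^sub>E carrier G. of_int (sign p) * ?t p i) = (- 1) ^ card V * (\<Prod>v\<in>V. of_bool (E v (p v)))"
    proof (cases "\<forall>v\<in>V. E v (p v)")
      case True
      have "of_int (sign p) * (\<Sum>i \<in> V \<rightarrow>\<^sub>E carrier G. \<Prod>v\<in>V. reduced_regular_rep G (l v (p v)) (i v) (i (p v)))
        = (- 1) ^ card V"
      proof (rule sum_prod_cycle_decomp [OF fin cycle_decomposition [OF p V]])
        show "(\<lambda>v. l v (p v)) \<in> V \<rightarrow> carrier G" using True p by (auto intro!: l simp: permutes_in_image)
        fix cs assume "distinct cs" "cs \<noteq> []" "set cs \<subseteq> V" "map p cs = rotate1 cs"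
        thus "label_product G (\<lambda>v. l v (p v)) cs \<noteq> \<one>" by (rule no) (use True \<open>set cs \<subseteq> V\<close> in blast)
      qed
      thus ?thesis using True by (simp add: sum_distrib_left)
    next
      case False
      then obtain v where "v \<in> V" "\<not> E v (p v)" by blast
      hence "?t p i = 0" "(\<Prod>v\<in>V. of_bool (E v (p v)) :: complex) = 0" for i
        using V by (auto intro!: prod_zero)
      thus ?thesis by simp
    qed
  qed
  also have "\<dots> = (- 1) ^ card V * of_real (permanent V (\<lambda>u v. of_bool (E u v)))"
  proof -
    have "complex_of_real (of_bool P) = of_bool P" for P by (cases P) auto
    thus ?thesis by (simp add: permanent_def sum_distrib_left)
  qed
  finally show ?thesis .
qed

theorem theorem3p1:
  fixes \<Gamma> :: "('g, 'm) monoid_scheme"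
    and D :: "('a, 'b) pre_digraph"
    and w :: "'b \<Rightarrow> 'g"
    and k d :: nat
  assumes "group \<Gamma>"
    and "finite (carrier \<Gamma>)"
    and "order \<Gamma> = k"
    and "k \<ge> 2"
    and "digraph D"
    and "verts D \<noteq> {}"
    and "regular_digraph D d"
    and "w \<in> arcs D \<rightarrow> carrier \<Gamma>"
    and "real d \<ge> exp 1 ^ 3 * (real k - 1)"
  shows "\<exists>p. zero_sum_cycle \<Gamma> D w p"
proof (rule ccontr)
  assume no_cycle: "\<not> ?thesis"
  interpret group \<Gamma> by fact
  interpret digraph D by fact
  define V where "V = verts D"
  define n where "n = card V"
  define K where "K = carrier \<Gamma>"
  define E where "E u v \<longleftrightarrow> (\<exists>e\<in>arcs D. tail D e = u \<and> head D e = v)" for u v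
  \<comment> \<open>The choice is meaningful only if \<open>E u v\<close> holds; otherwise the
    factor \<open>of_bool\<close> makes the block of \<open>B\<close> vanish.\<close>
  define a where "a u v = (SOME e. e \<in> arcs D \<and> tail D e = u \<and> head D e = v)" for u v
  define B where "B s t = of_bool (E (fst s) (fst t)) *
      reduced_regular_rep \<Gamma> (w (a (fst s) (fst t))) (snd s) (snd t)" for s t
  \<comment> \<open>The squared norm of a row of \<open>B\<close>: \<open>d\<close> nonzero blocks,
    each contributing \<open>1 - 1 / k\<close>. The radius \<open>r\<close> is set so that
    \<open>r\<^sup>2 * \<beta> = 1 / k\<close>, which makes
    \<open>(1 + r\<^sup>2 * \<beta>) ^ k\<close> less than \<open>exp 1\<close>.\<close>
  define \<beta> where "\<beta> = real d * (1 - 1 / real k)"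
  define r where "r = sqrt (1 / (real d * (real k - 1)))"
  have V: "finite V" "V \<noteq> {}" using assms(6) by (simp_all add: V_def)
  have n: "n > 0" using V by (simp add: n_def card_gt_0_iff)
  have K: "finite K" "K \<noteq> {}" "card K = k" using assms(2,3) by (auto simp: K_def order_def)
  have k: "real k \<ge> 2" using assms(4) by simp
  have d: "real d > 0"
  proof -
    have "0 < exp 1 ^ 3 * (real k - 1)" using k by simp
    thus ?thesis using assms(9) by linarith
  qed
  have r2: "r\<^sup>2 = 1 / (real d * (real k - 1))"
    using d k by (simp add: r_def)
  have a: "a u v \<in> arcs D \<and> tail D (a u v) = u \<and> head D (a u v) = v" if "E u v" for u v
    using someI_ex [of "\<lambda>e. e \<in> arcs D \<and> tail D e = u \<and> head D e = v"] that
    unfolding a_def E_def by blast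
  have irrefl: "\<not> E v v" for v using no_loops unfolding E_def by metis
  have out: "card {u \<in> V. E v u} = d" and in': "card {u \<in> V. E u v} = d" if "v \<in> V" for v
    using that assms(7) card_out_neighbours [of v] card_in_neighbours [of v]
    by (simp_all add: E_def V_def regular_digraph_def)
  have rows: "(\<Sum>u\<in>V. of_bool (E v u)) = real d" and cols: "(\<Sum>u\<in>V. of_bool (E u v)) = real d"
    if "v \<in> V" for v
    using out [OF that] in' [OF that] V by (simp_all add: Int_def)
  have per: "(real d / exp 1) ^ n \<le> permanent V (\<lambda>u v. of_bool (E u v))"
    unfolding n_def using V d rows cols by (intro permanent_ge_exp) auto

  have "(r ^ n * norm (\<Sum>i \<in> V \<rightarrow>\<^sub>E K. set_det V (\<lambda>u v. B (u, i u) (v, i v))))\<^sup>2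
      \<le> (1 + r\<^sup>2 * \<beta>) ^ (n * card K)"
    unfolding n_def
  proof (rule transversal_set_det_bound)
    show "r > 0" using d k by (simp add: r_def)
    show "B s s = 0" for s by (simp add: B_def irrefl)
    fix s assume s: "s \<in> V \<times> K"
    have "(\<Sum>t\<in>V \<times> K. (norm (B s t))\<^sup>2) = (\<Sum>v\<in>V. \<Sum>h\<in>K. (norm (B s (v, h)))\<^sup>2)"
      by (simp add: sum.cartesian_product case_prod_unfold)
    also have "\<dots> = (\<Sum>v\<in>V. of_bool (E (fst s) v) * (1 - 1 / real k))"
    proof (intro sum.cong refl)
      fix v assume "v \<in> V"
      show "(\<Sum>h\<in>K. (norm (B s (v, h)))\<^sup>2) = of_bool (E (fst s) v) * (1 - 1 / real k)"
      proof (cases "E (fst s) v")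
        case True
        have "w (a (fst s) v) \<in> carrier \<Gamma>" using a [OF True] assms(8) by auto
        moreover have "snd s \<in> carrier \<Gamma>" using s by (auto simp: K_def)
        ultimately have "(\<Sum>h\<in>K. (norm (reduced_regular_rep \<Gamma> (w (a (fst s) v)) (snd s) h))\<^sup>2) = 1 - 1 / real k"
          using row_norm_reduced_regular_rep [OF assms(2)] by (simp only: K_def assms(3))
        thus ?thesis using True by (simp add: B_def)
      qed (simp add: B_def)
    qed
    also have "\<dots> = \<beta>"
      using s rows [of "fst s"] by (simp only: sum_distrib_right [symmetric] \<beta>_def) auto
    finally show "(\<Sum>t\<in>V \<times> K. (norm (B s t))\<^sup>2) = \<beta>" .
  qed (use V K in auto)
  also have "(\<Sum>i \<in> V \<rightarrow>\<^sub>E K. set_det V (\<lambda>u v. B (u, i u) (v, i v)))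
      = (- 1) ^ n * of_real (permanent V (\<lambda>u v. of_bool (E u v)))"
    unfolding B_def fst_conv snd_conv K_def n_def
  proof (rule sum_set_det_eq_permanent)
    show "w (a u v) \<in> carrier \<Gamma>" if "E u v" for u v using a [OF that] assms(8) by auto
    fix cs s assume cs: "distinct cs" "cs \<noteq> []" "map s cs = rotate1 cs"
      and E: "\<And>x. x \<in> set cs \<Longrightarrow> E x (s x)"
    show "label_product \<Gamma> (\<lambda>x. w (a x (s x))) cs \<noteq> \<one>\<^bsub>\<Gamma>\<^esub>"
    proof
      assume "label_product \<Gamma> (\<lambda>x. w (a x (s x))) cs = \<one>\<^bsub>\<Gamma>\<^esub>"
      hence "zero_sum_cycle \<Gamma> D w (map (\<lambda>x. a x (s x)) cs)"
        by (intro zero_sum_cycle_of_orbit [OF wf_digraph cs]) (use a E in auto)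
      thus False using no_cycle by blast
    qed
  qed (use assms(2) V in auto)
  finally have "(r ^ n * \<bar>permanent V (\<lambda>u v. of_bool (E u v))\<bar>)\<^sup>2 \<le> (1 + r\<^sup>2 * \<beta>) ^ (n * k)"
    using K by (simp add: norm_mult norm_power)
  moreover have "(r ^ n * (real d / exp 1) ^ n)\<^sup>2 \<le> (r ^ n * \<bar>permanent V (\<lambda>u v. of_bool (E u v))\<bar>)\<^sup>2"
    using per d k by (intro power_mono mult_left_mono) (auto simp: r_def)
  \<comment> \<open>Both sides are grouped as \<open>n\<close>-th powers, so the number of vertices
    drops out.\<close>
  ultimately have "(r\<^sup>2 * (real d / exp 1)\<^sup>2) ^ n \<le> ((1 + r\<^sup>2 * \<beta>) ^ k) ^ n"
    by (simp add: power_mult_distrib power_mult [symmetric] mult.commute)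
  hence "r\<^sup>2 * (real d / exp 1)\<^sup>2 \<le> (1 + r\<^sup>2 * \<beta>) ^ k"
    using n d k by (subst (asm) power_mono_iff) (auto simp: \<beta>_def intro!: add_nonneg_nonneg)
  moreover have "r\<^sup>2 * \<beta> = 1 / real k"
  proof -
    have "1 - 1 / real k = (real k - 1) / real k" using k by (simp add: diff_divide_distrib)
    thus ?thesis using d k by (simp add: r2 \<beta>_def)
  qed
  moreover have "r\<^sup>2 * (real d / exp 1)\<^sup>2 = real d / (exp 1 ^ 2 * (real k - 1))"
    using d k unfolding r2 power_divide by (simp add: power2_eq_square)
  moreover have "(1 + 1 / real k) ^ k < exp 1"
    using assms(4) by (intro one_plus_inverse_power_less_exp) simp
  \<comment> \<open>Of the three factors \<open>exp 1\<close> in the final bound, two come from the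
    squared permanent bound and one from Hadamard's inequality.\<close>
  ultimately have "real d / (exp 1 ^ 2 * (real k - 1)) < exp 1" by simp
  hence "real d < exp 1 * (exp 1 ^ 2 * (real k - 1))" using k by (subst (asm) pos_divide_less_eq) auto
  also have "\<dots> = exp 1 ^ 3 * (real k - 1)" by (simp add: power2_eq_square power3_eq_cube)
  finally show False using assms(9) by simp
qed

end
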